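(* Let $M$ be a smooth connected manifold of dimension $n\ge 2$. Let $F_0$ be a Finsler function on $M$ of scalar flag curvature $\kappa_0$, where $\kappa_0\in C^\infty(T_0M)$ is non-vanishing on $T_0M$, and let $S_0$ be the geodesic spray of $F_0$. Then there is no Funk function $P$ for $S_0$, with $P$ not identically zero, such that the projectively related spray $S=S_0-2P\mathbb{C}$ is Finsler metrizable.
   Context: Let $M$ be an $n$-dimensional smooth connected manifold, $TM$ its tangent bundle with induced coordinates $(x^i,y^i)$, and $T_0M=TM\setminus\{0\}$ the tangent bundle with the zero section removed. Let $\mathbb{C}=y^i\frac{\partial}{\partial y^i}$ be the Liouville vector field and $J=\frac{\partial}{\partial y^i}\otimes dx^i$ the tangent structure. "$k$-homogeneous" means positively homogeneous of degree $k$ in the fiber coordinates $y$. For a vector valued $1$-form $L$ on $T_0M$ and a function $f$, $d_Lf=df\circ L$; thus $d_Jf=\frac{\partial f}{\partial y^i}dx^i$. For a vector field $X$, $[X,L]$ denotes the Lie derivative of $L$ along $X$, i.e. $[X,L](Y)=[X,LY]-L[X,Y]$. Spray: a smooth vector field $S$ on $T_0M$ with $JS=\mathbb{C}$ and $[\mathbb{C},S]=S$; locally $S=y^i\frac{\partial}{\partial x^i}-2G^i(x,y)\frac{\partial}{\partial y^i}$ with $G^i$ $2$-homogeneous. Its horizontal projector is $h=\frac12(\mathrm{Id}-[S,J])$, and its Jacobi endomorphism (Riemann curvature) is the vector valued $1$-form $\Phi=(\mathrm{Id}-h)\circ[S,h]$. Two sprays $S_0,S$ are projectively related if $S=S_0-2P\mathbb{C}$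 for some $1$-homogeneous smooth function $P$ on $T_0M$. Funk function for a spray $S_0$: a $1$-homogeneous smooth function $P$ on $T_0M$ such that $S_0$ and $S_0-2P\mathbb{C}$ have the same Jacobi endomorphism; equivalently, $d_{h_0}P=P\,d_JP$, where $h_0$ is the horizontal projector of $S_0$. Finsler function: a continuous non-negative function $F:TM\to\mathbb{R}$ such that (i) $F$ is smooth on $T_0M$ and $F(x,y)=0$ if and only if $y=0$; (ii) $F$ is $1$-homogeneous; (iii) the $2$-form $dd_JF^2$ is symplectic on $T_0M$. The geodesic spray of $F$ is the spray $S$ satisfying $i_Sdd_JF^2=-dF^2$ (for a spray this is equivalent to $d_hF^2=0$). A spray is Finsler metrizable if it is the geodesic spray of some Finsler function. A Finsler function $F$ with geodesic spray $S$ has scalar flag curvature $\kappa\in C^\infty(T_0M)$ if the Jacobi endomorphism of $S$ is $\Phi=\kappa\,(F^2J-F\,d_JF\otimes\mathbb{C})$. *)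

theory Defs
  imports "HOL-Analysis.Analysis"
begin

section \<open>Smooth maps between Euclidean spaces\<close>

(* Intended for open S only. *)
primrec Ck_on :: "nat \<Rightarrow> ('a::euclidean_space \<Rightarrow> 'b::euclidean_space) \<Rightarrow> 'a set \<Rightarrow> bool" where
  "Ck_on 0 f S \<longleftrightarrow> continuous_on S f"
| "Ck_on (Suc k) f S \<longleftrightarrow>
     f differentiable_on S \<and> (\<forall>v. Ck_on k (\<lambda>x. frechet_derivative f (at x) v) S)"

definition smooth_on :: "('a::euclidean_space \<Rightarrow> 'b::euclidean_space) \<Rightarrow> 'a set \<Rightarrow> bool" where
  "smooth_on f S \<longleftrightarrow> (\<forall>k. Ck_on k f S)"


section \<open>Smooth manifolds\<close>

(* A chart is a pair (U, phi); the values of phi outside U are irrelevant.  A manifold is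
   given by an atlas A: its underlying set is the union of the chart domains, its topology
   is the one that makes all charts homeomorphisms onto their (open) images. *)

type_synonym ('p, 'e) chart = "'p set \<times> ('p \<Rightarrow> 'e)"

definition points :: "('p, 'e) chart set \<Rightarrow> 'p set" where
  "points A = \<Union> (fst ` A)"

definition chart_inv :: "('p, 'e) chart \<Rightarrow> 'e \<Rightarrow> 'p" where
  "chart_inv c = inv_into (fst c) (snd c)"

definition transition :: "('p, 'e) chart \<Rightarrow> ('p, 'e) chart \<Rightarrow> 'e \<Rightarrow> 'e" where
  "transition c d = snd d \<circ> chart_inv c"

definition smooth_atlas :: "('p, 'e::euclidean_space) chart set \<Rightarrow> bool" where
  "smooth_atlas A \<longleftrightarrow>
     (\<forall>c\<in>A. inj_on (snd c) (fst c)) \<and>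
     (\<forall>c\<in>A. \<forall>d\<in>A. open (snd c ` (fst c \<inter> fst d)) \<and>
                    smooth_on (transition c d) (snd c ` (fst c \<inter> fst d)))"

definition atlas_topology :: "('p, 'e::euclidean_space) chart set \<Rightarrow> 'p topology" where
  "atlas_topology A =
     topology (\<lambda>W. W \<subseteq> points A \<and> (\<forall>c\<in>A. open (snd c ` (W \<inter> fst c))))"

lemma openin_atlas_topology:
  assumes "smooth_atlas A"
  shows "openin (atlas_topology A) W \<longleftrightarrow>
           W \<subseteq> points A \<and> (\<forall>c\<in>A. open (snd c ` (W \<inter> fst c)))"
proof -
  have "istopology (\<lambda>W. W \<subseteq> points A \<and> (\<forall>c\<in>A. open (snd c ` (W \<inter> fst c))))"
    unfolding istopology_def
  proof (intro conjI allI impI ballI)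
    fix S T c
    assume S: "S \<subseteq> points A \<and> (\<forall>c\<in>A. open (snd c ` (S \<inter> fst c)))"
      and T: "T \<subseteq> points A \<and> (\<forall>c\<in>A. open (snd c ` (T \<inter> fst c)))" and c: "c \<in> A"
    have "inj_on (snd c) (fst c)" using assms c by (auto simp: smooth_atlas_def)
    then have "snd c ` (S \<inter> T \<inter> fst c) = snd c ` (S \<inter> fst c) \<inter> snd c ` (T \<inter> fst c)"
      by (auto simp: inj_on_def image_iff)
    then show "open (snd c ` (S \<inter> T \<inter> fst c))" using S T c by auto
  next
    fix K c
    assume K: "\<forall>S\<in>K. S \<subseteq> points A \<and> (\<forall>c\<in>A. open (snd c ` (S \<inter> fst c)))" and c: "c \<in> A"
    have "snd c ` (\<Union>K \<inter> fst c) = (\<Union>S\<in>K. snd c ` (S \<inter> fst c))" by auto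
    then show "open (snd c ` (\<Union>K \<inter> fst c))" using K c by auto
  qed auto
  then show ?thesis unfolding atlas_topology_def by (simp add: topology_inverse')
qed

definition smooth_manifold :: "('p, 'e::euclidean_space) chart set \<Rightarrow> bool" where
  "smooth_manifold A \<longleftrightarrow>
     smooth_atlas A \<and> Hausdorff_space (atlas_topology A) \<and> second_countable (atlas_topology A)"

definition smooth_fun :: "('p, 'e::euclidean_space) chart set \<Rightarrow> ('p \<Rightarrow> real) \<Rightarrow> bool" where
  "smooth_fun A f \<longleftrightarrow> (\<forall>c\<in>A. smooth_on (f \<circ> chart_inv c) (snd c ` fst c))"


section \<open>Tangent vectors, vector fields, differential forms\<close>

(* A tangent vector at p is the family of its components in all charts at p, related by the
   derivatives of the transition maps; the components in all other charts are set to 0. *)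

type_synonym ('p, 'e) tvec = "('p, 'e) chart \<Rightarrow> 'e"
type_synonym ('p, 'e) vfield = "'p \<Rightarrow> ('p, 'e) tvec"

definition charts_at :: "('p, 'e) chart set \<Rightarrow> 'p \<Rightarrow> ('p, 'e) chart set" where
  "charts_at A p = {c \<in> A. p \<in> fst c}"

definition tangent_space :: "('p, 'e::euclidean_space) chart set \<Rightarrow> 'p \<Rightarrow> ('p, 'e) tvec set" where
  "tangent_space A p =
     {v. (\<forall>c\<in>charts_at A p. \<forall>d\<in>charts_at A p.
            v d = frechet_derivative (transition c d) (at (snd c p)) (v c)) \<and>
         (\<forall>c. c \<notin> charts_at A p \<longrightarrow> v c = 0)}"

definition vector_field_on ::
    "('p, 'e::euclidean_space) chart set \<Rightarrow> 'p set \<Rightarrow> ('p, 'e) vfield \<Rightarrow> bool" where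
  "vector_field_on A W X \<longleftrightarrow>
     openin (atlas_topology A) W \<and>
     (\<forall>p\<in>W. X p \<in> tangent_space A p) \<and>
     (\<forall>c\<in>A. smooth_on (\<lambda>z. X (chart_inv c z) c) (snd c ` (W \<inter> fst c)))"

(* X(f); the chart is arbitrary *)
definition vf_apply ::
    "('p, 'e::euclidean_space) chart set \<Rightarrow> ('p, 'e) vfield \<Rightarrow> ('p \<Rightarrow> real) \<Rightarrow> 'p \<Rightarrow> real" where
  "vf_apply A X f p =
     (let c = SOME c. c \<in> charts_at A p
      in frechet_derivative (f \<circ> chart_inv c) (at (snd c p)) (X p c))"

definition lie_bracket ::
    "('p, 'e::euclidean_space) chart set \<Rightarrow> ('p, 'e) vfield \<Rightarrow> ('p, 'e) vfield \<Rightarrow> ('p, 'e) vfield"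
  where
  "lie_bracket A X Y = (\<lambda>p c.
     if c \<in> charts_at A p
     then frechet_derivative (\<lambda>z. Y (chart_inv c z) c) (at (snd c p)) (X p c)
        - frechet_derivative (\<lambda>z. X (chart_inv c z) c) (at (snd c p)) (Y p c)
     else 0)"

(* Scalar and vector valued forms are represented by their action on vector fields.  Being
   tensorial, they act on vector fields defined on any open set; two of them coincide iff they
   agree on all such local vector fields. *)

type_synonym ('p, 'e) form1 = "('p, 'e) vfield \<Rightarrow> 'p \<Rightarrow> real"
type_synonym ('p, 'e) form2 = "('p, 'e) vfield \<Rightarrow> ('p, 'e) vfield \<Rightarrow> 'p \<Rightarrow> real"
type_synonym ('p, 'e) vform1 = "('p, 'e) vfield \<Rightarrow> ('p, 'e) vfield"

definition vform1_eq ::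
    "('p, 'e::euclidean_space) chart set \<Rightarrow> ('p, 'e) vform1 \<Rightarrow> ('p, 'e) vform1 \<Rightarrow> bool" where
  "vform1_eq A K L \<longleftrightarrow> (\<forall>W Y. vector_field_on A W Y \<longrightarrow> (\<forall>p\<in>W. K Y p = L Y p))"

definition d0 :: "('p, 'e::euclidean_space) chart set \<Rightarrow> ('p \<Rightarrow> real) \<Rightarrow> ('p, 'e) form1" where
  "d0 A f = (\<lambda>Y. vf_apply A Y f)"

definition d_along ::
    "('p, 'e::euclidean_space) chart set \<Rightarrow> ('p, 'e) vform1 \<Rightarrow> ('p \<Rightarrow> real) \<Rightarrow> ('p, 'e) form1" where
  "d_along A L f = d0 A f \<circ> L"

definition d1 :: "('p, 'e::euclidean_space) chart set \<Rightarrow> ('p, 'e) form1 \<Rightarrow> ('p, 'e) form2" where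
  "d1 A \<alpha> = (\<lambda>X Y p.
     vf_apply A X (\<alpha> Y) p - vf_apply A Y (\<alpha> X) p - \<alpha> (lie_bracket A X Y) p)"

definition closed_form2 :: "('p, 'e::euclidean_space) chart set \<Rightarrow> ('p, 'e) form2 \<Rightarrow> bool" where
  "closed_form2 A \<omega> \<longleftrightarrow>
     (\<forall>W X Y Z. vector_field_on A W X \<longrightarrow> vector_field_on A W Y \<longrightarrow> vector_field_on A W Z \<longrightarrow>
        (\<forall>p\<in>W. vf_apply A X (\<omega> Y Z) p - vf_apply A Y (\<omega> X Z) p + vf_apply A Z (\<omega> X Y) p
              - \<omega> (lie_bracket A X Y) Z p + \<omega> (lie_bracket A X Z) Y p
              - \<omega> (lie_bracket A Y Z) X p = 0))"

definition nondegenerate_form2 ::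
    "('p, 'e::euclidean_space) chart set \<Rightarrow> ('p, 'e) form2 \<Rightarrow> bool" where
  "nondegenerate_form2 A \<omega> \<longleftrightarrow>
     (\<forall>W X. vector_field_on A W X \<longrightarrow>
        (\<forall>p\<in>W. (\<forall>Y. vector_field_on A W Y \<longrightarrow> \<omega> X Y p = 0) \<longrightarrow> X p = (\<lambda>_. 0)))"

definition symplectic :: "('p, 'e::euclidean_space) chart set \<Rightarrow> ('p, 'e) form2 \<Rightarrow> bool" where
  "symplectic A \<omega> \<longleftrightarrow> closed_form2 A \<omega> \<and> nondegenerate_form2 A \<omega>"

definition lie_vform1 ::
    "('p, 'e::euclidean_space) chart set \<Rightarrow> ('p, 'e) vfield \<Rightarrow> ('p, 'e) vform1 \<Rightarrow> ('p, 'e) vform1"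
  where
  "lie_vform1 A X L = (\<lambda>Y p c. lie_bracket A X (L Y) p c - L (lie_bracket A X Y) p c)"


section \<open>The tangent bundle\<close>

type_synonym ('m, 'e) tpoint = "'m \<times> ('m, 'e) tvec"

(* the chart (x,y) of TM induced by a chart x of M *)
definition TM_chart ::
    "('m, 'e::euclidean_space) chart set \<Rightarrow> ('m, 'e) chart \<Rightarrow> (('m, 'e) tpoint, 'e \<times> 'e) chart" where
  "TM_chart A c = ({(p, v). p \<in> fst c \<and> v \<in> tangent_space A p}, \<lambda>(p, v). (snd c p, v c))"

definition TM :: "('m, 'e::euclidean_space) chart set \<Rightarrow> (('m, 'e) tpoint, 'e \<times> 'e) chart set" where
  "TM A = TM_chart A ` A"

definition T0M_chart ::
    "('m, 'e::euclidean_space) chart set \<Rightarrow> ('m, 'e) chart \<Rightarrow> (('m, 'e) tpoint, 'e \<times> 'e) chart" where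
  "T0M_chart A c =
     ({(p, v). p \<in> fst c \<and> v \<in> tangent_space A p \<and> v \<noteq> (\<lambda>_. 0)}, \<lambda>(p, v). (snd c p, v c))"

definition T0M :: "('m, 'e::euclidean_space) chart set \<Rightarrow> (('m, 'e) tpoint, 'e \<times> 'e) chart set" where
  "T0M A = T0M_chart A ` A"

type_synonym ('m, 'e) T_vfield = "(('m, 'e) tpoint, 'e \<times> 'e) vfield"
type_synonym ('m, 'e) T_vform1 = "(('m, 'e) tpoint, 'e \<times> 'e) vform1"

definition fiber_scale :: "real \<Rightarrow> ('m, 'e::euclidean_space) tpoint \<Rightarrow> ('m, 'e) tpoint" where
  "fiber_scale t u = (fst u, \<lambda>c. t *\<^sub>R snd u c)"

definition homogeneous1_on ::
    "('m, 'e::euclidean_space) tpoint set \<Rightarrow> (('m, 'e) tpoint \<Rightarrow> real) \<Rightarrow> bool" where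
  "homogeneous1_on W f \<longleftrightarrow> (\<forall>u\<in>W. \<forall>t>0. f (fiber_scale t u) = t * f u)"

definition liouville :: "('m, 'e::euclidean_space) chart set \<Rightarrow> ('m, 'e) T_vfield" where
  "liouville A = (\<lambda>u c. if c \<in> charts_at (T0M A) u then (0, snd (snd c u)) else 0)"

(* J = d/dy^i (x) dx^i; this formula refers only to the induced charts (x,y), which is
   legitimate since T0M A consists of such charts *)
definition tan_J :: "('m, 'e::euclidean_space) T_vform1" where
  "tan_J Y = (\<lambda>u c. (0, fst (Y u c)))"


section \<open>Sprays and Finsler functions\<close>

definition spray :: "('m, 'e::euclidean_space) chart set \<Rightarrow> ('m, 'e) T_vfield \<Rightarrow> bool" where
  "spray A S \<longleftrightarrow>
     vector_field_on (T0M A) (points (T0M A)) S \<and>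
     (\<forall>u\<in>points (T0M A). tan_J S u = liouville A u) \<and>
     (\<forall>u\<in>points (T0M A). lie_bracket (T0M A) (liouville A) S u = S u)"

definition hor :: "('m, 'e::euclidean_space) chart set \<Rightarrow> ('m, 'e) T_vfield \<Rightarrow> ('m, 'e) T_vform1" where
  "hor A S = (\<lambda>Y u c. (1/2) *\<^sub>R (Y u c - lie_vform1 (T0M A) S tan_J Y u c))"

definition jacobi_endo ::
    "('m, 'e::euclidean_space) chart set \<Rightarrow> ('m, 'e) T_vfield \<Rightarrow> ('m, 'e) T_vform1" where
  "jacobi_endo A S =
     (\<lambda>Y u c. lie_vform1 (T0M A) S (hor A S) Y u c
            - hor A S (lie_vform1 (T0M A) S (hor A S) Y) u c)"

definition projective_change ::
    "('m, 'e::euclidean_space) chart set \<Rightarrow> ('m, 'e) T_vfield \<Rightarrow> (('m, 'e) tpoint \<Rightarrow> real)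
      \<Rightarrow> ('m, 'e) T_vfield" where
  "projective_change A S P = (\<lambda>u c. S u c - (2 * P u) *\<^sub>R liouville A u c)"

definition funk_function ::
    "('m, 'e::euclidean_space) chart set \<Rightarrow> ('m, 'e) T_vfield \<Rightarrow> (('m, 'e) tpoint \<Rightarrow> real) \<Rightarrow> bool"
  where
  "funk_function A S P \<longleftrightarrow>
     smooth_fun (T0M A) P \<and> homogeneous1_on (points (T0M A)) P \<and>
     vform1_eq (T0M A) (jacobi_endo A S) (jacobi_endo A (projective_change A S P))"

definition dd_J_sq ::
    "('m, 'e::euclidean_space) chart set \<Rightarrow> (('m, 'e) tpoint \<Rightarrow> real)
      \<Rightarrow> (('m, 'e) tpoint, 'e \<times> 'e) form2" where
  "dd_J_sq A F = d1 (T0M A) (d_along (T0M A) tan_J (\<lambda>u. (F u)\<^sup>2))"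

definition finsler_function ::
    "('m, 'e::euclidean_space) chart set \<Rightarrow> (('m, 'e) tpoint \<Rightarrow> real) \<Rightarrow> bool" where
  "finsler_function A F \<longleftrightarrow>
     continuous_map (atlas_topology (TM A)) euclideanreal F \<and>
     (\<forall>u\<in>points (TM A). F u \<ge> 0) \<and>
     smooth_fun (T0M A) F \<and>
     (\<forall>u\<in>points (TM A). F u = 0 \<longleftrightarrow> snd u = (\<lambda>_. 0)) \<and>
     homogeneous1_on (points (TM A)) F \<and>
     symplectic (T0M A) (dd_J_sq A F)"

definition geodesic_spray ::
    "('m, 'e::euclidean_space) chart set \<Rightarrow> (('m, 'e) tpoint \<Rightarrow> real) \<Rightarrow> ('m, 'e) T_vfield \<Rightarrow> bool"
  where
  "geodesic_spray A F S \<longleftrightarrow>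
     spray A S \<and>
     (\<forall>W Y. vector_field_on (T0M A) W Y \<longrightarrow>
        (\<forall>u\<in>W. dd_J_sq A F S Y u = - d0 (T0M A) (\<lambda>u. (F u)\<^sup>2) Y u))"

definition finsler_metrizable ::
    "('m, 'e::euclidean_space) chart set \<Rightarrow> ('m, 'e) T_vfield \<Rightarrow> bool" where
  "finsler_metrizable A S \<longleftrightarrow> (\<exists>F. finsler_function A F \<and> geodesic_spray A F S)"

(* Phi = kappa (F^2 J - F d_J F (x) C), Phi being the Jacobi endomorphism of the geodesic
   spray S of F *)
definition scalar_flag_curvature ::
    "('m, 'e::euclidean_space) chart set \<Rightarrow> (('m, 'e) tpoint \<Rightarrow> real) \<Rightarrow> ('m, 'e) T_vfield
      \<Rightarrow> (('m, 'e) tpoint \<Rightarrow> real) \<Rightarrow> bool" where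
  "scalar_flag_curvature A F S \<kappa> \<longleftrightarrow>
     smooth_fun (T0M A) \<kappa> \<and>
     vform1_eq (T0M A) (jacobi_endo A S)
       (\<lambda>Y u c. \<kappa> u *\<^sub>R ((F u)\<^sup>2 *\<^sub>R tan_J Y u c
                       - (F u * d_along (T0M A) tan_J F Y u) *\<^sub>R liouville A u c))"

end

theory Submission
  imports Defs
begin

text \<open>Suppose that \<open>F\<close> metrizes \<open>S = S\<^sub>0 - 2PC\<close>. The energy \<open>F\<^sup>2\<close> is constant along the horizontal
  distribution of \<open>S\<close> and along \<open>S\<close>, hence it is annihilated by \<open>[S, hX]\<close> and by the Jacobi
  endomorphism of \<open>S\<close>. The latter equals that of \<open>S\<^sub>0\<close>, which is
  \<open>\<kappa>\<^sub>0 (F\<^sub>0\<^sup>2 J - F\<^sub>0 d\<^sub>JF\<^sub>0 \<otimes> C)\<close> with \<open>\<kappa>\<^sub>0 \<noteq> 0\<close>, so \<open>r = F\<^sup>2/F\<^sub>0\<^sup>2\<close> satisfies \<open>d\<^sub>J r = 0\<close>.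
  Comparing \<open>d\<^sub>h F\<^sup>2 = 0\<close> with \<open>d\<^sub>h\<^sub>0 F\<^sub>0\<^sup>2 = 0\<close>
  expresses \<open>dr\<close> through \<open>P\<close>; evaluated on \<open>y\<close> it gives \<open>r\<^sub>x(y) = 4rP\<close>, so \<open>P\<close> is linear on the
  fibres, and evaluated on an arbitrary vector it gives \<open>2 F\<^sub>0\<^sup>2 d\<^sub>J P = P d\<^sub>J F\<^sub>0\<^sup>2\<close>.
  As \<open>n \<ge> 2\<close>, the linear form \<open>P\<close> has a nontrivial zero in each fibre, where the last equation
  forces \<open>d\<^sub>J P = 0\<close>.\<close>

section \<open>Calculus of smooth maps\<close>

abbreviation D :: "('a::euclidean_space \<Rightarrow> 'b::euclidean_space) \<Rightarrow> 'a \<Rightarrow> 'a \<Rightarrow> 'b" where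
  "D f z \<equiv> frechet_derivative f (at z)"

lemma D_eqI: "(f has_derivative f') (at z) \<Longrightarrow> D f z = f'"
  using frechet_derivative_at by metis

lemma has_derivative_D: "f differentiable at z \<Longrightarrow> (f has_derivative D f z) (at z)"
  by (simp add: frechet_derivative_works)

lemma linear_D: "f differentiable at z \<Longrightarrow> linear (D f z)"
  by (rule linear_frechet_derivative)

text \<open>No differentiability is assumed: \<open>frechet_derivative\<close> is a Hilbert choice
  among all derivatives at the point, and functions that agree near \<open>z\<close> have the same
  ones. Local representatives may thus be exchanged freely under \<open>D\<close>.\<close>

lemma D_cong:
  assumes "open S" "z \<in> S" "\<And>x. x \<in> S \<Longrightarrow> f x = g x"
  shows "D f z = D g z"
proof (cases "f differentiable at z")
  case True
  then show ?thesis using assms by (rule frechet_derivative_transform_within_open)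
next
  case False
  have "(f has_derivative f') (at z) \<longleftrightarrow> (g has_derivative f') (at z)" for f'
    using assms by (metis has_derivative_transform_within_open)
  then show ?thesis by (simp add: frechet_derivative_def)
qed

section \<open>Closure properties of the classes C^k\<close>

lemma Ck_on_cong:
  assumes "open S" "\<And>x. x \<in> S \<Longrightarrow> f x = g x"
  shows "Ck_on k f S \<longleftrightarrow> Ck_on k g S"
  using assms(2)
proof (induction k arbitrary: f g)
  case 0
  then show ?case by (auto intro: continuous_on_cong)
next
  case (Suc k)
  have "Ck_on k (\<lambda>x. D f x v) S \<longleftrightarrow> Ck_on k (\<lambda>x. D g x v) S" for v
    by (rule Suc.IH) (use D_cong[OF \<open>open S\<close>, of _ f g] Suc.prems in auto)
  moreover have "f differentiable_on S \<longleftrightarrow> g differentiable_on S"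
    unfolding differentiable_on_def using Suc.prems
    by (metis differentiable_transform_within zero_less_one)
  ultimately show ?case by simp
qed

lemma Ck_on_subset: "Ck_on k f S \<Longrightarrow> T \<subseteq> S \<Longrightarrow> Ck_on k f T"
  by (induction k arbitrary: f) (auto intro: continuous_on_subset differentiable_on_subset)

lemma Ck_on_SucD: "Ck_on (Suc k) f S \<Longrightarrow> Ck_on k f S"
proof (induction k arbitrary: f)
  case 0
  then show ?case by (auto intro: differentiable_imp_continuous_on)
next
  case (Suc k)
  from Suc.prems have "f differentiable_on S" "\<And>v. Ck_on (Suc k) (\<lambda>x. D f x v) S"
    by (auto simp only: Ck_on.simps(2))
  then show ?case using Suc.IH by simp
qed

lemma Ck_on_Suc_differentiable: "Ck_on (Suc k) f S \<Longrightarrow> open S \<Longrightarrow> x \<in> S \<Longrightarrow> f differentiable at x"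
  by (simp add: differentiable_on_eq_differentiable_at)

lemma Ck_on_const: "Ck_on k (\<lambda>x. c) S"
  by (induction k arbitrary: c) auto

lemma Ck_on_linear:
  fixes f :: "'a::euclidean_space \<Rightarrow> 'b::euclidean_space"
  assumes "linear f"
  shows "Ck_on k f S"
proof -
  have "bounded_linear f" using assms by (simp add: linear_linear)
  then have d: "(f has_derivative f) (at x)" for x by (rule bounded_linear_imp_has_derivative)
  then have "D f x = f" for x by (rule D_eqI)
  moreover have "f differentiable_on S"
    using d by (meson differentiableI differentiable_at_imp_differentiable_on)
  ultimately show ?thesis
    by (cases k) (auto intro: Ck_on_const differentiable_imp_continuous_on)
qed

lemma Ck_on_linear_comp:
  fixes L :: "'b::euclidean_space \<Rightarrow> 'c::euclidean_space"
  assumes "linear L" "open S" "Ck_on k f S"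
  shows "Ck_on k (\<lambda>x. L (f x)) S"
  using assms(3)
proof (induction k arbitrary: f)
  case 0
  have "continuous_on UNIV L" using assms(1) by (simp add: linear_continuous_on linear_linear)
  with 0 show ?case by (simp add: continuous_on_compose2)
next
  case (Suc k)
  have bl: "bounded_linear L" using assms by (simp add: linear_linear)
  have d: "((\<lambda>x. L (f x)) has_derivative (\<lambda>v. L (D f x v))) (at x)" if "x \<in> S" for x
    using bounded_linear.has_derivative[OF bl] has_derivative_D
      Ck_on_Suc_differentiable[OF Suc.prems \<open>open S\<close> that] by blast
  then have "Ck_on k (\<lambda>x. D (\<lambda>x. L (f x)) x v) S" for v
    using Ck_on_cong[OF \<open>open S\<close>, of "\<lambda>x. D (\<lambda>x. L (f x)) x v" "\<lambda>x. L (D f x v)"]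
      Suc.IH[of "\<lambda>x. D f x v"] Suc.prems D_eqI[OF d] by simp
  moreover have "(\<lambda>x. L (f x)) differentiable_on S"
    using d by (meson differentiableI differentiable_at_imp_differentiable_on)
  ultimately show ?case by simp
qed

lemma Ck_on_add:
  assumes "open S" "Ck_on k f S" "Ck_on k g S"
  shows "Ck_on k (\<lambda>x. f x + g x) S"
  using assms(2,3)
proof (induction k arbitrary: f g)
  case 0
  then show ?case by (auto intro: continuous_on_add)
next
  case (Suc k)
  have d: "((\<lambda>x. f x + g x) has_derivative (\<lambda>v. D f x v + D g x v)) (at x)" if "x \<in> S" for x
    using that Suc.prems \<open>open S\<close>
    by (intro has_derivative_add has_derivative_D Ck_on_Suc_differentiable)
  then have "Ck_on k (\<lambda>x. D (\<lambda>x. f x + g x) x v) S" for v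
    using Ck_on_cong[OF \<open>open S\<close>, of "\<lambda>x. D (\<lambda>x. f x + g x) x v" "\<lambda>x. D f x v + D g x v"]
      Suc.IH[of "\<lambda>x. D f x v" "\<lambda>x. D g x v"] Suc.prems D_eqI[OF d] by simp
  moreover have "(\<lambda>x. f x + g x) differentiable_on S"
    using d by (meson differentiableI differentiable_at_imp_differentiable_on)
  ultimately show ?case by simp
qed

lemma Ck_on_scaleR:
  fixes f :: "'a::euclidean_space \<Rightarrow> real"
  assumes "open S" "Ck_on k f S" "Ck_on k g S"
  shows "Ck_on k (\<lambda>x. f x *\<^sub>R g x) S"
  using assms(2,3)
proof (induction k arbitrary: f g)
  case 0
  then show ?case by (auto intro: continuous_on_scaleR)
next
  case (Suc k)
  have d: "((\<lambda>x. f x *\<^sub>R g x) has_derivative (\<lambda>v. f x *\<^sub>R D g x v + D f x v *\<^sub>R g x)) (at x)"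
    if "x \<in> S" for x
    using that Suc.prems \<open>open S\<close>
    by (intro has_derivative_scaleR has_derivative_D Ck_on_Suc_differentiable)
  \<comment> \<open>The product rule leaves \<open>f\<close> and \<open>g\<close> undifferentiated;
    as factors they are one order smoother than the induction hypothesis asks for.\<close>
  have "Ck_on k (\<lambda>x. f x *\<^sub>R D g x v + D f x v *\<^sub>R g x) S" for v
    using Suc.prems Ck_on_SucD[OF Suc.prems(1)] Ck_on_SucD[OF Suc.prems(2)]
    by (intro Ck_on_add[OF \<open>open S\<close>] Suc.IH) auto
  then have "Ck_on k (\<lambda>x. D (\<lambda>x. f x *\<^sub>R g x) x v) S" for v
    using Ck_on_cong[OF \<open>open S\<close>, of "\<lambda>x. D (\<lambda>x. f x *\<^sub>R g x) x v"
          "\<lambda>x. f x *\<^sub>R D g x v + D f x v *\<^sub>R g x"] D_eqI[OF d] by simp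
  moreover have "(\<lambda>x. f x *\<^sub>R g x) differentiable_on S"
    using d by (meson differentiableI differentiable_at_imp_differentiable_on)
  ultimately show ?case by simp
qed

lemma Ck_on_sum:
  assumes "open S" "finite I" "\<And>i. i \<in> I \<Longrightarrow> Ck_on k (f i) S"
  shows "Ck_on k (\<lambda>x. \<Sum>i\<in>I. f i x) S"
  using assms(2,3) by (induction I) (auto simp: Ck_on_const intro: Ck_on_add[OF \<open>open S\<close>])

text \<open>\<open>Ck_on\<close> speaks of derivatives in fixed directions only. The expansion turns
  a derivative in a varying direction into a finite sum of products of known factors.\<close>

lemma D_basis_expansion:
  fixes f :: "'a::euclidean_space \<Rightarrow> 'b::euclidean_space"
  assumes "f differentiable at z"
  shows "D f z v = (\<Sum>b\<in>Basis. (v \<bullet> b) *\<^sub>R D f z b)"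
proof -
  have "D f z v = D f z (\<Sum>b\<in>Basis. (v \<bullet> b) *\<^sub>R b)" by (simp add: euclidean_representation)
  also have "\<dots> = (\<Sum>b\<in>Basis. (v \<bullet> b) *\<^sub>R D f z b)"
    using linear_D[OF assms] by (simp add: linear_sum linear_scale)
  finally show ?thesis .
qed

lemma linear_inner_left: "linear (\<lambda>x. x \<bullet> b)"
  by (simp add: linear_iff inner_add_left)

lemma Ck_on_inner_left: "open S \<Longrightarrow> Ck_on k f S \<Longrightarrow> Ck_on k (\<lambda>x. f x \<bullet> b) S"
  by (rule Ck_on_linear_comp[OF linear_inner_left])

text \<open>By the chain rule and basis expansion, the derivative of the composite is a sum of
  products of \<open>D f x v \<bullet> b\<close> and \<open>D g (f x) b\<close>. The induction
  leaves \<open>g\<close> arbitrary, so that its hypothesis covers the maps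
  \<open>\<lambda>x. D g x b\<close>.\<close>

lemma Ck_on_compose:
  fixes f :: "'a::euclidean_space \<Rightarrow> 'b::euclidean_space"
    and g :: "'b \<Rightarrow> 'c::euclidean_space"
  assumes "open S" "open T" "f ` S \<subseteq> T" "Ck_on k f S" "Ck_on k g T"
  shows "Ck_on k (\<lambda>x. g (f x)) S"
  using assms(4,5)
proof (induction k arbitrary: g)
  case 0
  then show ?case using assms(3) by (auto intro: continuous_on_compose2)
next
  case (Suc k)
  have df: "f differentiable at x" if "x \<in> S" for x
    by (rule Ck_on_Suc_differentiable[OF Suc.prems(1) \<open>open S\<close> that])
  have dg: "g differentiable at (f x)" if "x \<in> S" for x
    by (rule Ck_on_Suc_differentiable[OF Suc.prems(2) \<open>open T\<close>]) (use that assms(3) in blast)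
  have d: "((\<lambda>x. g (f x)) has_derivative (\<lambda>v. D g (f x) (D f x v))) (at x)" if "x \<in> S" for x
    using diff_chain_at[OF has_derivative_D[OF df[OF that]] has_derivative_D[OF dg[OF that]]]
    by (simp add: o_def)
  have "Ck_on k (\<lambda>x. D f x v) S" "Ck_on k (\<lambda>x. D g x b) T" for v b
    using Suc.prems by simp_all
  then have summand: "Ck_on k (\<lambda>x. (D f x v \<bullet> b) *\<^sub>R D g (f x) b) S" for v b
    using Ck_on_scaleR[OF \<open>open S\<close> Ck_on_inner_left[OF \<open>open S\<close>] Suc.IH] Ck_on_SucD[OF Suc.prems(1)]
    by blast
  have "Ck_on k (\<lambda>x. \<Sum>b\<in>Basis. (D f x v \<bullet> b) *\<^sub>R D g (f x) b) S" for v
    by (rule Ck_on_sum[OF \<open>open S\<close> finite_Basis summand])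
  moreover have "D (\<lambda>x. g (f x)) x v = (\<Sum>b\<in>Basis. (D f x v \<bullet> b) *\<^sub>R D g (f x) b)"
    if "x \<in> S" for x v
    unfolding D_eqI[OF d[OF that]] by (rule D_basis_expansion[OF dg[OF that]])
  ultimately have "Ck_on k (\<lambda>x. D (\<lambda>x. g (f x)) x v) S" for v
    using Ck_on_cong[OF \<open>open S\<close>, of "\<lambda>x. D (\<lambda>x. g (f x)) x v"] by simp
  moreover have "(\<lambda>x. g (f x)) differentiable_on S"
    using d by (meson differentiableI differentiable_at_imp_differentiable_on)
  ultimately show ?case by simp
qed

text \<open>The derivative of 1/f is -f'/f^2, in which 1/f itself recurs; the induction hypothesis
  covers that factor, at one order less, for the same \<open>f\<close>.\<close>

lemma Ck_on_inverse:
  fixes f :: "'a::euclidean_space \<Rightarrow> real"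
  assumes "open S" "\<And>x. x \<in> S \<Longrightarrow> f x \<noteq> 0" "Ck_on k f S"
  shows "Ck_on k (\<lambda>x. inverse (f x)) S"
  using assms(3)
proof (induction k)
  case 0
  then show ?case using assms(2) by (auto intro: continuous_on_inverse)
next
  case (Suc k)
  have d: "((\<lambda>x. inverse (f x)) has_derivative (\<lambda>v. (- D f x v) *\<^sub>R inverse (f x) *\<^sub>R inverse (f x))) (at x)"
    if "x \<in> S" for x
    using Deriv.has_derivative_inverse[OF assms(2)[OF that] has_derivative_D[OF Ck_on_Suc_differentiable[OF Suc.prems \<open>open S\<close> that]]]
    by (simp add: mult_ac)
  have "Ck_on k (\<lambda>x. inverse (f x)) S" using Suc.IH Ck_on_SucD[OF Suc.prems] by blast
  moreover have "linear (\<lambda>x::real. - x)" by (simp add: linear_iff)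
  ultimately have "Ck_on k (\<lambda>x. (- D f x v) *\<^sub>R inverse (f x) *\<^sub>R inverse (f x)) S" for v
    using Suc.prems by (intro Ck_on_scaleR \<open>open S\<close> Ck_on_linear_comp[of "\<lambda>x. - x"]) auto
  then have "Ck_on k (\<lambda>x. D (\<lambda>x. inverse (f x)) x v) S" for v
    using Ck_on_cong[OF \<open>open S\<close>, of "\<lambda>x. D (\<lambda>x. inverse (f x)) x v"] D_eqI[OF d] by simp
  moreover have "(\<lambda>x. inverse (f x)) differentiable_on S"
    using d by (meson differentiableI differentiable_at_imp_differentiable_on)
  ultimately show ?case by simp
qed

section \<open>Closure properties of smooth maps\<close>

lemma smooth_on_cong:
  assumes "open S" "\<And>x. x \<in> S \<Longrightarrow> f x = g x"
  shows "smooth_on f S \<longleftrightarrow> smooth_on g S"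
  unfolding smooth_on_def using Ck_on_cong[OF assms] by simp

lemma smooth_on_subset: "smooth_on f S \<Longrightarrow> T \<subseteq> S \<Longrightarrow> smooth_on f T"
  unfolding smooth_on_def using Ck_on_subset by blast

lemma smooth_on_differentiable:
  assumes "smooth_on f S" "open S" "x \<in> S"
  shows "f differentiable at x"
  using assms Ck_on_Suc_differentiable unfolding smooth_on_def by blast

lemma smooth_on_continuous: "smooth_on f S \<Longrightarrow> continuous_on S f"
  unfolding smooth_on_def by (metis Ck_on.simps(1))

lemma smooth_on_const: "smooth_on (\<lambda>x. c) S"
  by (simp add: smooth_on_def Ck_on_const)

lemma smooth_on_linear: "linear f \<Longrightarrow> smooth_on f S"
  by (simp add: smooth_on_def Ck_on_linear)

lemma smooth_on_linear_comp:
  "linear L \<Longrightarrow> open S \<Longrightarrow> smooth_on f S \<Longrightarrow> smooth_on (\<lambda>x. L (f x)) S"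
  by (simp add: smooth_on_def Ck_on_linear_comp)

lemma smooth_on_add:
  "open S \<Longrightarrow> smooth_on f S \<Longrightarrow> smooth_on g S \<Longrightarrow> smooth_on (\<lambda>x. f x + g x) S"
  by (simp add: smooth_on_def Ck_on_add)

lemma smooth_on_diff:
  assumes "open S" "smooth_on f S" "smooth_on g S"
  shows "smooth_on (\<lambda>x. f x - g x) S"
proof -
  have "linear (\<lambda>x::'b. - x)" by (simp add: linear_iff)
  from smooth_on_add[OF assms(1,2) smooth_on_linear_comp[OF this assms(1,3)]]
  show ?thesis by simp
qed

lemma smooth_on_scaleR:
  "open S \<Longrightarrow> smooth_on f S \<Longrightarrow> smooth_on g S \<Longrightarrow> smooth_on (\<lambda>x. f x *\<^sub>R g x) S"
  by (simp add: smooth_on_def Ck_on_scaleR)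

lemma smooth_on_mult:
  fixes f g :: "_ \<Rightarrow> real"
  shows "open S \<Longrightarrow> smooth_on f S \<Longrightarrow> smooth_on g S \<Longrightarrow> smooth_on (\<lambda>x. f x * g x) S"
  using smooth_on_scaleR[of S f g] by simp

lemma smooth_on_inverse:
  fixes f :: "_ \<Rightarrow> real"
  shows "open S \<Longrightarrow> (\<And>x. x \<in> S \<Longrightarrow> f x \<noteq> 0) \<Longrightarrow> smooth_on f S \<Longrightarrow> smooth_on (\<lambda>x. inverse (f x)) S"
  by (simp add: smooth_on_def Ck_on_inverse)

lemma smooth_on_compose:
  "open S \<Longrightarrow> open T \<Longrightarrow> f ` S \<subseteq> T \<Longrightarrow> smooth_on f S \<Longrightarrow> smooth_on g T \<Longrightarrow> smooth_on (\<lambda>x. g (f x)) S"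
  unfolding smooth_on_def using Ck_on_compose by blast

lemma smooth_on_Pair:
  fixes f :: "'a::euclidean_space \<Rightarrow> 'b::euclidean_space" and g :: "'a \<Rightarrow> 'c::euclidean_space"
  assumes "open S" "smooth_on f S" "smooth_on g S"
  shows "smooth_on (\<lambda>x. (f x, g x)) S"
proof -
  have "linear (\<lambda>x::'b. (x, 0::'c))" "linear (\<lambda>x::'c. (0::'b, x))" by (auto simp: linear_iff)
  from smooth_on_add[OF assms(1) smooth_on_linear_comp[OF this(1) assms(1,2)]
       smooth_on_linear_comp[OF this(2) assms(1,3)]]
  show ?thesis by simp
qed

lemma smooth_on_snd: "open S \<Longrightarrow> smooth_on f S \<Longrightarrow> smooth_on (\<lambda>x. snd (f x)) S"
  by (rule smooth_on_linear_comp) (rule linear_snd)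

lemma smooth_on_D: "smooth_on f S \<Longrightarrow> smooth_on (\<lambda>x. D f x v) S"
  unfolding smooth_on_def by (metis Ck_on.simps(2))

text \<open>For expressions whose base point and direction both vary, such as the fibre part
  \<open>D (transition c d) x y\<close> of a transition map of the tangent bundle.\<close>

lemma smooth_on_D_apply:
  fixes f :: "'a::euclidean_space \<Rightarrow> 'b::euclidean_space" and g :: "'c::euclidean_space \<Rightarrow> 'a"
  assumes "open S" "open T" "k ` T \<subseteq> S" "smooth_on f S" "smooth_on k T" "smooth_on g T"
  shows "smooth_on (\<lambda>x. D f (k x) (g x)) T"
proof -
  have summand: "smooth_on (\<lambda>x. (g x \<bullet> b) *\<^sub>R D f (k x) b) T" for b
    using smooth_on_compose[OF assms(2,1,3,5) smooth_on_D[OF assms(4), of b]]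
    by (rule smooth_on_scaleR[OF \<open>open T\<close> smooth_on_linear_comp[OF linear_inner_left \<open>open T\<close> assms(6)]])
  have "smooth_on (\<lambda>x. \<Sum>b\<in>Basis. (g x \<bullet> b) *\<^sub>R D f (k x) b) T"
    unfolding smooth_on_def
    by (intro allI Ck_on_sum[OF \<open>open T\<close> finite_Basis] summand[unfolded smooth_on_def, rule_format])
  moreover have "D f (k x) (g x) = (\<Sum>b\<in>Basis. (g x \<bullet> b) *\<^sub>R D f (k x) b)" if "x \<in> T" for x
    using assms that by (intro D_basis_expansion smooth_on_differentiable[OF assms(4)]) auto
  ultimately show ?thesis using smooth_on_cong[OF \<open>open T\<close>] by (metis (no_types, lifting))
qed

section \<open>Symmetry of second derivatives\<close>

lemma second_difference:
  fixes g :: "'a::euclidean_space \<Rightarrow> real"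
  assumes S: "open S" "ball z r \<subseteq> S" and g: "smooth_on g S"
    and h: "0 < h" "h * (norm v + norm w) < r"
  shows "\<exists>x\<in>ball z r. g (z + h *\<^sub>R v + h *\<^sub>R w) - g (z + h *\<^sub>R v) - g (z + h *\<^sub>R w) + g z
           = h * h * D (\<lambda>x. D g x v) x w"
proof -
  have mem: "z + s *\<^sub>R v + t *\<^sub>R w \<in> ball z r" if "0 \<le> s" "s \<le> h" "0 \<le> t" "t \<le> h" for s t
  proof -
    have "norm (s *\<^sub>R v + t *\<^sub>R w) \<le> s * norm v + t * norm w"
      using norm_triangle_ineq[of "s *\<^sub>R v" "t *\<^sub>R w"] that by simp
    also have "\<dots> \<le> h * norm v + h * norm w"
      using that by (intro add_mono mult_right_mono) auto
    also have "\<dots> < r" using h by (simp add: algebra_simps)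
    moreover have "dist z (z + s *\<^sub>R v + t *\<^sub>R w) = norm (- (s *\<^sub>R v + t *\<^sub>R w))"
      unfolding dist_norm by (simp add: algebra_simps)
    ultimately show ?thesis by (simp only: mem_ball norm_minus_cancel)
  qed
  have dg: "g differentiable at x" "(\<lambda>x. D g x v) differentiable at x" if "x \<in> ball z r" for x
    using smooth_on_differentiable[OF g S(1)] smooth_on_differentiable[OF smooth_on_D[OF g] S(1)] that S
    by auto
  have d1: "((\<lambda>t. g (z + t *\<^sub>R v + s *\<^sub>R w)) has_real_derivative D g (z + t *\<^sub>R v + s *\<^sub>R w) v) (at t)"
    if "0 \<le> t" "t \<le> h" "0 \<le> s" "s \<le> h" for s t
  proof -
    have a: "((\<lambda>t. z + t *\<^sub>R v + s *\<^sub>R w) has_derivative (\<lambda>e. e *\<^sub>R v)) (at t)"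
      by (auto intro!: derivative_eq_intros)
    from diff_chain_at[OF a has_derivative_D[OF dg(1)[OF mem[OF that]]]]
    show ?thesis
      using linear_scale[OF linear_D[OF dg(1)[OF mem[OF that]]]]
      by (simp add: o_def has_field_derivative_def mult.commute[of _ "D g _ v"])
  qed
  have d2: "((\<lambda>t. D g (z + s *\<^sub>R v + t *\<^sub>R w) v) has_real_derivative
              D (\<lambda>x. D g x v) (z + s *\<^sub>R v + t *\<^sub>R w) w) (at t)"
    if "0 \<le> t" "t \<le> h" "0 \<le> s" "s \<le> h" for s t
  proof -
    have a: "((\<lambda>t. z + s *\<^sub>R v + t *\<^sub>R w) has_derivative (\<lambda>e. e *\<^sub>R w)) (at t)"
      by (auto intro!: derivative_eq_intros)
    have m: "z + s *\<^sub>R v + t *\<^sub>R w \<in> ball z r" using mem that by blast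
    from diff_chain_at[OF a has_derivative_D[OF dg(2)[OF m]]]
    show ?thesis
      using linear_scale[OF linear_D[OF dg(2)[OF m]]]
      by (simp add: o_def has_field_derivative_def mult.commute[of _ "D (\<lambda>x. D g x v) _ w"])
  qed
  \<comment> \<open>Mean value theorem in the direction \<open>v\<close> for the increment of
    \<open>g\<close> along \<open>h w\<close>. The zero coefficients keep all four corners in the
    form that \<open>d1\<close> covers.\<close>
  have "\<exists>t. 0 < t \<and> t < h \<and>
      (g (z + h *\<^sub>R v + h *\<^sub>R w) - g (z + h *\<^sub>R v + 0 *\<^sub>R w)) - (g (z + 0 *\<^sub>R v + h *\<^sub>R w) - g (z + 0 *\<^sub>R v + 0 *\<^sub>R w))
      = (h - 0) * (D g (z + t *\<^sub>R v + h *\<^sub>R w) v - D g (z + t *\<^sub>R v + 0 *\<^sub>R w) v)"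
    using h by (intro MVT2 DERIV_diff d1) auto
  then obtain t where t: "0 < t" "t < h"
    "g (z + h *\<^sub>R v + h *\<^sub>R w) - g (z + h *\<^sub>R v) - g (z + h *\<^sub>R w) + g z
      = h * (D g (z + t *\<^sub>R v + h *\<^sub>R w) v - D g (z + t *\<^sub>R v + 0 *\<^sub>R w) v)"
    by (auto simp: algebra_simps)
  \<comment> \<open>Mean value theorem again, now in the direction \<open>w\<close>, for the
    derivative of \<open>g\<close> in the direction \<open>v\<close>.\<close>
  have "\<exists>s. 0 < s \<and> s < h \<and> D g (z + t *\<^sub>R v + h *\<^sub>R w) v - D g (z + t *\<^sub>R v + 0 *\<^sub>R w) v
      = (h - 0) * D (\<lambda>x. D g x v) (z + t *\<^sub>R v + s *\<^sub>R w) w"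
    using h t by (intro MVT2) (auto intro!: d2)
  then obtain s where s: "0 < s" "s < h" "D g (z + t *\<^sub>R v + h *\<^sub>R w) v - D g (z + t *\<^sub>R v + 0 *\<^sub>R w) v
      = h * D (\<lambda>x. D g x v) (z + t *\<^sub>R v + s *\<^sub>R w) w" by auto
  show ?thesis
    using s t mem[of t s] by (intro bexI[of _ "z + t *\<^sub>R v + s *\<^sub>R w"]) auto
qed

text \<open>The second difference over the parallelogram spanned by \<open>h v\<close> and
  \<open>h w\<close> is symmetric in \<open>v\<close> and \<open>w\<close>. It equals h^2 times
  either mixed derivative, each taken at some point near \<open>z\<close>. As \<open>A\<close> and
  \<open>B\<close> are continuous they cannot differ at \<open>z\<close>; \<open>e\<close> is half
  of the supposed gap.\<close>

lemma D_D_commute_real: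
  fixes g :: "'a::euclidean_space \<Rightarrow> real"
  assumes "open S" "smooth_on g S" "z \<in> S"
  shows "D (\<lambda>x. D g x v) z w = D (\<lambda>x. D g x w) z v"
proof (rule ccontr)
  define A B where "A = (\<lambda>x. D (\<lambda>x. D g x v) x w)" and "B = (\<lambda>x. D (\<lambda>x. D g x w) x v)"
  define e where "e = \<bar>A z - B z\<bar> / 2"
  assume "D (\<lambda>x. D g x v) z w \<noteq> D (\<lambda>x. D g x w) z v"
  then have "e > 0" by (simp add: e_def A_def B_def)
  have "isCont A z" "isCont B z"
    using assms smooth_on_continuous[OF smooth_on_D[OF smooth_on_D[OF assms(2)]]]
    by (auto simp: A_def B_def continuous_on_eq_continuous_at)
  then obtain r1 r2 where r12: "r1 > 0" "\<And>x. dist x z < r1 \<Longrightarrow> dist (A x) (A z) < e"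
      "r2 > 0" "\<And>x. dist x z < r2 \<Longrightarrow> dist (B x) (B z) < e"
    using \<open>e > 0\<close> unfolding continuous_at_eps_delta by metis
  obtain r3 where r3: "r3 > 0" "ball z r3 \<subseteq> S" using assms openE by blast
  define r where "r = min r1 (min r2 r3)"
  have r: "r > 0" "ball z r \<subseteq> S" using r12 r3 by (auto simp: r_def)
  \<comment> \<open>The summand 1 keeps the denominator positive when both vectors vanish.\<close>
  define h where "h = r / (2 * (norm v + norm w + 1))"
  have n: "norm v + norm w + 1 > 0" by (simp add: add_nonneg_pos)
  have h: "h > 0" using r n by (simp add: h_def)
  have "h * (norm v + norm w) < h * (2 * (norm v + norm w + 1))"
    using h n by (intro mult_strict_left_mono) auto
  also have "\<dots> = r" using n by (simp add: h_def)
  finally have hr: "h * (norm v + norm w) < r" .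
  obtain x where x: "x \<in> ball z r" "g (z + h *\<^sub>R v + h *\<^sub>R w) - g (z + h *\<^sub>R v) - g (z + h *\<^sub>R w) + g z = h * h * A x"
    using second_difference[OF assms(1) r(2) assms(2) h hr] by (auto simp: A_def)
  have hr': "h * (norm w + norm v) < r" using hr by (simp add: add.commute)
  obtain y where y: "y \<in> ball z r" "g (z + h *\<^sub>R w + h *\<^sub>R v) - g (z + h *\<^sub>R w) - g (z + h *\<^sub>R v) + g z = h * h * B y"
    using second_difference[OF assms(1) r(2) assms(2) h hr'] by (auto simp: B_def)
  have "h * h * A x = h * h * B y" using x(2) y(2) by (simp add: algebra_simps)
  then have "A x = B y" using h by simp
  moreover have "dist (A x) (A z) < e" "dist (B y) (B z) < e"
    using r12 x y by (auto simp: r_def dist_commute)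
  ultimately show False unfolding e_def dist_real_def by (smt (verit) field_sum_of_halves)
qed

lemma D_inner:
  assumes "f differentiable at z"
  shows "D (\<lambda>x. f x \<bullet> b) z v = D f z v \<bullet> b"
  using D_eqI[OF has_derivative_inner_left[OF has_derivative_D[OF assms], of b]] by simp

theorem D_D_commute:
  fixes f :: "'a::euclidean_space \<Rightarrow> 'b::euclidean_space"
  assumes "open S" "smooth_on f S" "z \<in> S"
  shows "D (\<lambda>x. D f x v) z w = D (\<lambda>x. D f x w) z v"
proof (rule euclidean_eqI)
  fix b :: 'b assume "b \<in> Basis"
  have s: "smooth_on (\<lambda>x. f x \<bullet> b) S"
    using smooth_on_linear_comp[OF linear_inner_left assms(1,2)] .
  have "D (\<lambda>x. D f x v) z w \<bullet> b = D (\<lambda>x. D (\<lambda>x. f x \<bullet> b) x v) z w" for v w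
  proof -
    have "D (\<lambda>x. D f x v) z w \<bullet> b = D (\<lambda>x. D f x v \<bullet> b) z w"
      using D_inner smooth_on_differentiable[OF smooth_on_D[OF assms(2)] assms(1,3)] by metis
    also have "\<dots> = D (\<lambda>x. D (\<lambda>x. f x \<bullet> b) x v) z w"
      by (subst D_cong[OF assms(1,3)]) (auto simp: D_inner smooth_on_differentiable[OF assms(2,1)])
    finally show ?thesis .
  qed
  then show "D (\<lambda>x. D f x v) z w \<bullet> b = D (\<lambda>x. D f x w) z v \<bullet> b"
    using D_D_commute_real[OF assms(1) s assms(3)] by simp
qed

section \<open>Sprays in a chart\<close>

lemma has_derivative_D_apply:
  fixes f :: "'a::euclidean_space \<Rightarrow> 'b::euclidean_space"
  assumes "open S" "smooth_on f S" "z \<in> S" "k differentiable at z"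
  shows "((\<lambda>x. D f x (k x)) has_derivative
           (\<lambda>v. D (\<lambda>x. D f x (k z)) z v + D f z (D k z v))) (at z)"
proof -
  have dk: "(k has_derivative D k z) (at z)" using has_derivative_D assms(4) .
  have df: "((\<lambda>x. D f x b) has_derivative D (\<lambda>x. D f x b) z) (at z)" for b
    using smooth_on_differentiable[OF smooth_on_D[OF assms(2)] assms(1,3)] by (rule has_derivative_D)
  have expand: "D f x v = (\<Sum>b\<in>Basis. (v \<bullet> b) *\<^sub>R D f x b)" if "x \<in> S" for x v
    by (rule D_basis_expansion[OF smooth_on_differentiable[OF assms(2,1) that]])
  \<comment> \<open>Coefficients frozen at \<open>k z\<close> give the first term of the claim; with
    \<open>k x\<close> in their place the product rule adds the term with the derivative of
    \<open>k\<close>.\<close>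
  have "((\<lambda>x. \<Sum>b\<in>Basis. (k z \<bullet> b) *\<^sub>R D f x b) has_derivative
          (\<lambda>v. \<Sum>b\<in>Basis. (k z \<bullet> b) *\<^sub>R D (\<lambda>x. D f x b) z v)) (at z)"
    by (intro has_derivative_sum has_derivative_scaleR_right df)
  then have "((\<lambda>x. D f x (k z)) has_derivative
          (\<lambda>v. \<Sum>b\<in>Basis. (k z \<bullet> b) *\<^sub>R D (\<lambda>x. D f x b) z v)) (at z)"
    by (rule has_derivative_transform_within_open[OF _ assms(1,3)]) (simp add: expand[symmetric])
  then have second: "D (\<lambda>x. D f x (k z)) z = (\<lambda>v. \<Sum>b\<in>Basis. (k z \<bullet> b) *\<^sub>R D (\<lambda>x. D f x b) z v)"
    by (rule D_eqI)
  have "((\<lambda>x. \<Sum>b\<in>Basis. (k x \<bullet> b) *\<^sub>R D f x b) has_derivative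
          (\<lambda>v. \<Sum>b\<in>Basis. (k z \<bullet> b) *\<^sub>R D (\<lambda>x. D f x b) z v + (D k z v \<bullet> b) *\<^sub>R D f z b)) (at z)"
    by (intro has_derivative_sum has_derivative_scaleR has_derivative_inner_left df dk)
  then have "((\<lambda>x. D f x (k x)) has_derivative
          (\<lambda>v. \<Sum>b\<in>Basis. (k z \<bullet> b) *\<^sub>R D (\<lambda>x. D f x b) z v + (D k z v \<bullet> b) *\<^sub>R D f z b)) (at z)"
    by (rule has_derivative_transform_within_open[OF _ assms(1,3)]) (simp add: expand[symmetric])
  then show ?thesis
    unfolding second expand[OF assms(3), of "D k z _"] by (simp add: sum.distrib)
qed

lemma D_D_apply:
  assumes "open S" "smooth_on f S" "z \<in> S" "k differentiable at z"
  shows "D (\<lambda>x. D f x (k x)) z v = D (\<lambda>x. D f x (k z)) z v + D f z (D k z v)"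
  using D_eqI[OF has_derivative_D_apply[OF assms]] by simp

lemma D_zero_on:
  assumes "open S" "z \<in> S" "\<And>x. x \<in> S \<Longrightarrow> f x = 0"
  shows "D f z v = 0"
  using D_cong[OF assms(1,2), of f "\<lambda>x. 0"] assms(3) by simp

lemma D_D_apply_zero:
  assumes "open S" "smooth_on f S" "z \<in> S" "k differentiable at z"
    and "\<And>x. x \<in> S \<Longrightarrow> D f x (k x) = 0"
  shows "D (\<lambda>x. D f x (k z)) z v + D f z (D k z v) = 0"
  using D_D_apply[OF assms(1-4), of v] D_zero_on[OF assms(1,3), of "\<lambda>x. D f x (k x)" v] assms(5)
  by simp

text \<open>Differentiate Yf = 0 along X and Xf = 0 along Y and subtract: the second derivatives of
  \<open>f\<close> cancel by symmetry, and what remains is the coordinate bracket [X,Y] applied to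
  \<open>f\<close>.\<close>

lemma D_annihilates_bracket:
  assumes "open S" "smooth_on f S" "z \<in> S" "X differentiable at z" "Y differentiable at z"
    and X: "\<And>x. x \<in> S \<Longrightarrow> D f x (X x) = 0" and Y: "\<And>x. x \<in> S \<Longrightarrow> D f x (Y x) = 0"
  shows "D f z (D Y z (X z) - D X z (Y z)) = 0"
proof -
  have "D (\<lambda>x. D f x (Y z)) z (X z) + D f z (D Y z (X z)) = 0"
    by (rule D_D_apply_zero[OF assms(1-3,5) Y])
  moreover have "D (\<lambda>x. D f x (X z)) z (Y z) + D f z (D X z (Y z)) = 0"
    by (rule D_D_apply_zero[OF assms(1-4) X])
  ultimately show ?thesis
    using D_D_commute[OF assms(1-3), of "X z" "Y z"]
      linear_diff[OF linear_D[OF smooth_on_differentiable[OF assms(2,1,3)]]]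
    by (simp add: eq_neg_iff_add_eq_0[symmetric])
qed

text \<open>The horizontal lift of \<open>a\<close>: for \<open>s = (y, -2G)\<close> the second component is \<open>-\<partial>G/\<partial>y (a)\<close>.\<close>

definition hlift :: "('e \<times> 'e \<Rightarrow> 'e \<times> 'e) \<Rightarrow> 'e \<times> 'e \<Rightarrow> 'e \<Rightarrow> 'e \<times> 'e::euclidean_space" where
  "hlift s z a = (a, (1/2) *\<^sub>R snd (D s z (0, a)))"

section \<open>Conservation of energy along a spray, in a chart\<close>

lemma D_fst: "s differentiable at z \<Longrightarrow> D (\<lambda>x. fst (s x)) z v = fst (D s z v)"
  using D_eqI[OF has_derivative_fst[OF has_derivative_D]] by metis

lemma D_linear: "linear f \<Longrightarrow> D f z = f"
  by (rule D_eqI) (simp add: bounded_linear_imp_has_derivative linear_linear)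

lemma linear_vertical: "linear (\<lambda>z::'e::euclidean_space \<times> 'e. (0::'e, snd z))"
  and linear_turn: "linear (\<lambda>z::'e::euclidean_space \<times> 'e. (snd z, 0::'e))"
  by (auto simp: linear_iff)

lemma linear_differentiable:
  fixes f :: "'a::euclidean_space \<Rightarrow> 'b::euclidean_space"
  shows "linear f \<Longrightarrow> f differentiable at z"
  by (simp add: bounded_linear_imp_differentiable linear_linear)

text \<open>\<open>s\<close> is the component map of a spray in an induced chart (x,y), and
  \<open>fst_s\<close> is the condition JS = C.\<close>

locale spray_chart =
  fixes \<Omega> :: "('e::euclidean_space \<times> 'e) set" and s :: "'e \<times> 'e \<Rightarrow> 'e \<times> 'e"
  assumes \<Omega>: "open \<Omega>" and smooth_s: "smooth_on s \<Omega>" and fst_s: "z \<in> \<Omega> \<Longrightarrow> fst (s z) = snd z"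
begin

lemma s_differentiable: "z \<in> \<Omega> \<Longrightarrow> s differentiable at z"
  using smooth_on_differentiable[OF smooth_s \<Omega>] .

lemma fst_D_s: "z \<in> \<Omega> \<Longrightarrow> fst (D s z v) = snd v"
  using D_fst[OF s_differentiable, of z v] D_cong[OF \<Omega>, of z "\<lambda>x. fst (s x)" snd] fst_s
    D_linear[OF linear_snd] by metis

lemma smooth_hlift: "smooth_on (\<lambda>z. hlift s z a) \<Omega>"
  unfolding hlift_def
  by (intro smooth_on_Pair smooth_on_scaleR smooth_on_snd smooth_on_D smooth_on_const \<Omega> smooth_s)

text \<open>\<open>f\<close> stands for the square of a Finsler function: \<open>euler\<close>
  expresses its 2-homogeneity, and \<open>geodesic\<close> is the Euler-Lagrange equation S(df/dy) =
  df/dx.\<close>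

context
  fixes f :: "'e \<times> 'e \<Rightarrow> real"
  assumes smooth_f: "smooth_on f \<Omega>"
    and euler: "\<And>z. z \<in> \<Omega> \<Longrightarrow> D f z (0, snd z) = 2 * f z"
    and geodesic: "\<And>z a. z \<in> \<Omega> \<Longrightarrow> D (\<lambda>x. D f x (0, a)) z (s z) = D f z (a, 0)"
begin

lemma f_differentiable: "z \<in> \<Omega> \<Longrightarrow> f differentiable at z"
  using smooth_on_differentiable[OF smooth_f \<Omega>] .

text \<open>Differentiate the Euler identity f_y(y) = 2f along S. By \<open>geodesic\<close> the
  left side becomes f_x(y) plus f_y applied to the fibre part of \<open>s z\<close>, which is Sf
  because the base part of \<open>s z\<close> is y. Hence Sf = 2 Sf.\<close>

lemma spray_preserves_energy:
  assumes z: "z \<in> \<Omega>"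
  shows "D f z (s z) = 0"
proof -
  have "D (\<lambda>x. D f x (0, snd x)) z (s z) = D (\<lambda>x. 2 * f x) z (s z)"
    using D_cong[OF \<Omega> z, of "\<lambda>x. D f x (0, snd x)" "\<lambda>x. 2 * f x"] euler by simp
  also have "\<dots> = 2 * D f z (s z)"
    using D_eqI[OF has_derivative_mult_right[OF has_derivative_D[OF f_differentiable[OF z]]], of 2] by simp
  finally have "2 * D f z (s z) = D f z (snd z, 0) + D f z (0, snd (s z))"
    using D_D_apply[OF \<Omega> smooth_f z linear_differentiable[OF linear_vertical], of "s z"]
      geodesic[OF z, of "snd z"] by (simp add: D_linear[OF linear_vertical])
  also have "\<dots> = D f z (s z)"
    using linear_add[OF linear_D[OF f_differentiable[OF z]], of "(snd z, 0)" "(0, snd (s z))"] fst_s[OF z]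
    by (metis add.left_neutral add.right_neutral add_Pair prod.collapse)
  finally show ?thesis by simp
qed

text \<open>Differentiate Sf = 0 in the vertical direction \<open>(0, a)\<close>. Symmetry of second
  derivatives and \<open>geodesic\<close> turn the first term into f_x(a), and
  \<open>(a, 0) + D s z (0, a)\<close> is twice the horizontal lift of \<open>a\<close>.\<close>

lemma hlift_preserves_energy:
  assumes z: "z \<in> \<Omega>"
  shows "D f z (hlift s z a) = 0"
proof -
  have "D (\<lambda>x. D f x (s z)) z (0, a) + D f z (D s z (0, a)) = 0"
    by (rule D_D_apply_zero[OF \<Omega> smooth_f z s_differentiable[OF z] spray_preserves_energy])
  then have "D f z (a, 0) + D f z (D s z (0, a)) = 0"
    using D_D_commute[OF \<Omega> smooth_f z, of "s z" "(0, a)"] geodesic[OF z, of a] by simp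
  then have "D f z ((a, 0) + D s z (0, a)) = 0"
    using linear_add[OF linear_D[OF f_differentiable[OF z]]] by metis
  also have "(a, 0) + D s z (0, a) = 2 *\<^sub>R hlift s z a"
    using fst_D_s[OF z, of "(0, a)"]
    by (intro prod_eqI) (auto simp: hlift_def scaleR_2)
  finally show ?thesis
    using linear_scale[OF linear_D[OF f_differentiable[OF z]]] by (metis mult_eq_0_iff real_scaleR_def zero_neq_numeral)
qed

text \<open>The argument of \<open>D f z\<close> is the bracket of S with the horizontal lift of the
  constant vector \<open>a\<close>, two fields that annihilate \<open>f\<close>.\<close>

lemma bracket_preserves_energy:
  assumes z: "z \<in> \<Omega>"
  shows "D f z (D (\<lambda>x. hlift s x a) z (s z) - D s z (hlift s z a)) = 0"
  using smooth_on_differentiable[OF smooth_hlift \<Omega> z]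
  by (intro D_annihilates_bracket[OF \<Omega> smooth_f z s_differentiable[OF z]]
        spray_preserves_energy hlift_preserves_energy)

end

end

section \<open>The local argument for the projective factor\<close>

lemma linear_functional_kernel:
  fixes l :: "'e::euclidean_space \<Rightarrow> real"
  assumes "linear l" "2 \<le> DIM('e)"
  shows "\<exists>y. y \<noteq> 0 \<and> l y = 0"
proof -
  obtain T :: "'e set" where "T \<subseteq> Basis" "card T = 2"
    using obtain_subset_with_card_n[OF assms(2)] by metis
  then obtain b c :: 'e where bc: "b \<in> Basis" "c \<in> Basis" "b \<noteq> c" by (auto simp: card_2_iff)
  show ?thesis
  proof (cases "l b = 0")
    case True
    then show ?thesis using bc nonzero_Basis by blast
  next
    case False
    let ?y = "l b *\<^sub>R c - l c *\<^sub>R b"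
    have "?y \<bullet> c = l b" using bc by (simp add: inner_diff_left inner_Basis)
    then have "?y \<noteq> 0" using False by auto
    moreover have "l ?y = 0"
      using assms(1) by (simp add: linear_diff linear_scale mult.commute)
    ultimately show ?thesis by blast
  qed
qed

text \<open>The fibre without its origin is connected from dimension 2 on; in dimension 1 the two
  half-lines could carry different constants.\<close>

lemma fibrewise_constant:
  fixes g :: "'a::euclidean_space \<times> 'e::euclidean_space \<Rightarrow> real"
  assumes "2 \<le> DIM('e)" "\<And>y. y \<noteq> 0 \<Longrightarrow> g differentiable at (x, y)"
    and "\<And>y b. y \<noteq> 0 \<Longrightarrow> D g (x, y) (0, b) = 0" "y \<noteq> 0" "y' \<noteq> 0"
  shows "g (x, y) = g (x, y')"
proof (rule has_derivative_zero_unique_connected[of "- {0}" "\<lambda>y. g (x, y)"])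
  show "connected (- {0::'e})"
    using connected_punctured_universe assms(1) by blast
  show "((\<lambda>y. g (x, y)) has_derivative (\<lambda>b. 0)) (at y)" if "y \<in> - {0}" for y
  proof -
    have "((\<lambda>y. (x, y)) has_derivative (\<lambda>b. (0, b))) (at y)"
      by (auto intro!: derivative_eq_intros)
    from diff_chain_at[OF this has_derivative_D[OF assms(2)]] that
    show ?thesis using assms(3) by (simp add: o_def)
  qed
qed (use assms in auto)

text \<open>The analytic core, over a chart domain \<open>V\<close>, with \<open>f\<close> and
  \<open>f\<^sub>0\<close> for the squares of the two Finsler functions. The curvature enters only
  through \<open>vert\<close>, the two geodesic equations only through \<open>hor\<close> and
  \<open>hor0\<close>.\<close>

lemma projective_factor_vanishes:
  fixes V :: "'e::euclidean_space set" and f f\<^sub>0 P :: "'e \<times> 'e \<Rightarrow> real"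
  defines "\<Omega> \<equiv> V \<times> (- {0})"
  assumes dim: "2 \<le> DIM('e)" and V: "open V"
    and smooth: "smooth_on f \<Omega>" "smooth_on f\<^sub>0 \<Omega>" "smooth_on P \<Omega>" "smooth_on s\<^sub>0 \<Omega>"
    and f\<^sub>0_nonzero: "\<And>z. z \<in> \<Omega> \<Longrightarrow> f\<^sub>0 z \<noteq> 0" and f_nonzero: "\<And>z. z \<in> \<Omega> \<Longrightarrow> f z \<noteq> 0"
    and euler0: "\<And>z. z \<in> \<Omega> \<Longrightarrow> D f\<^sub>0 z (0, snd z) = 2 * f\<^sub>0 z"
    and eulerP: "\<And>z. z \<in> \<Omega> \<Longrightarrow> D P z (0, snd z) = P z"
    and hor0: "\<And>z a. z \<in> \<Omega> \<Longrightarrow> D f\<^sub>0 z (hlift s\<^sub>0 z a) = 0"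
    and hor: "\<And>z a. z \<in> \<Omega> \<Longrightarrow> D f z (hlift s z a) = 0"
    and s: "\<And>z. z \<in> \<Omega> \<Longrightarrow> s z = s\<^sub>0 z - (2 * P z) *\<^sub>R (0, snd z)"
    and vert: "\<And>z a. z \<in> \<Omega> \<Longrightarrow> f\<^sub>0 z * D f z (0, a) = f z * D f\<^sub>0 z (0, a)"
    and z: "z \<in> \<Omega>"
  shows "P z = 0"
proof -
  have \<Omega>: "open \<Omega>" using V by (simp add: \<Omega>_def open_Times open_Compl)
  define r where "r = (\<lambda>z. f z * inverse (f\<^sub>0 z))"
  have smooth_r: "smooth_on r \<Omega>"
    unfolding r_def by (intro smooth_on_mult smooth_on_inverse \<Omega> smooth f\<^sub>0_nonzero)
  have r_nonzero: "r z \<noteq> 0" if "z \<in> \<Omega>" for z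
    using f\<^sub>0_nonzero f_nonzero that by (simp add: r_def)
  have f_eq: "f z = r z * f\<^sub>0 z" if "z \<in> \<Omega>" for z using f\<^sub>0_nonzero that by (simp add: r_def)
  note diff = smooth_on_differentiable[OF _ \<Omega>]
  note lin = linear_D[OF diff]
  have D_f: "D f z v = r z * D f\<^sub>0 z v + D r z v * f\<^sub>0 z" if "z \<in> \<Omega>" for z v
    using D_cong[OF \<Omega> that, of f "\<lambda>z. r z * f\<^sub>0 z"] f_eq
      D_eqI[OF has_derivative_mult[OF has_derivative_D[OF diff[OF smooth_r that]]
        has_derivative_D[OF diff[OF smooth(2) that]]]] by simp
  \<comment> \<open>With f = r f0 inserted, \<open>vert\<close> reduces to f0^2 r_y(a) = 0.\<close>
  have D_r_vert: "D r z (0, a) = 0" if "z \<in> \<Omega>" for z a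
    using vert[OF that, of a] f\<^sub>0_nonzero[OF that]
    unfolding D_f[OF that] f_eq[OF that] by (simp add: algebra_simps)
  \<comment> \<open>The change of the horizontal projector under a projective change: h = h0 - P J -
    d_J P (x) C.\<close>
  have hl: "hlift s z a = hlift s\<^sub>0 z a - P z *\<^sub>R (0, a) - D P z (0, a) *\<^sub>R (0, snd z)"
    if "z \<in> \<Omega>" for z a
  proof -
    have "((\<lambda>z. s\<^sub>0 z - (2 * P z) *\<^sub>R (0, snd z)) has_derivative
        (\<lambda>v. D s\<^sub>0 z v - ((2 * P z) *\<^sub>R (0, snd v) + (2 * D P z v) *\<^sub>R (0, snd z)))) (at z)"
      by (intro has_derivative_diff has_derivative_scaleR has_derivative_mult_right has_derivative_D
          diff[OF smooth(4) that] diff[OF smooth(3) that] has_derivative_Pair has_derivative_const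
          has_derivative_snd has_derivative_ident)
    then have "D s z (0, a) = D s\<^sub>0 z (0, a) - ((2 * P z) *\<^sub>R (0, a) + (2 * D P z (0, a)) *\<^sub>R (0, snd z))"
      using D_cong[OF \<Omega> that s] D_eqI by fastforce
    then have "snd (D s z (0, a)) = snd (D s\<^sub>0 z (0, a)) - ((2 * P z) *\<^sub>R a + (2 * D P z (0, a)) *\<^sub>R snd z)"
      by simp
    then show ?thesis by (simp add: hlift_def scaleR_diff_right scaleR_add_right)
  qed
  \<comment> \<open>This is d_h f = 0 with \<open>hl\<close> inserted. Since r has no vertical
    derivative, r_x(a) is the derivative of r along the old lift, and f0 contributes nothing there
    by \<open>hor0\<close>.\<close>
  have conformal: "f\<^sub>0 z * D r z (a, 0) = P z * r z * D f\<^sub>0 z (0, a) + 2 * D P z (0, a) * r z * f\<^sub>0 z"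
    if "z \<in> \<Omega>" for z a
  proof -
    have "hlift s\<^sub>0 z a = (a, 0) + (0, snd (hlift s\<^sub>0 z a))" by (simp add: hlift_def)
    then have "D r z (hlift s\<^sub>0 z a) = D r z (a, 0)"
      using linear_add[OF lin[OF smooth_r that]] D_r_vert[OF that] by (metis add.right_neutral)
    then have "D f z (hlift s\<^sub>0 z a) = D r z (a, 0) * f\<^sub>0 z"
      using D_f[OF that] hor0[OF that] by simp
    moreover have "D f z (hlift s z a) = D f z (hlift s\<^sub>0 z a) - P z * D f z (0, a) - D P z (0, a) * D f z (0, snd z)"
      unfolding hl[OF that]
      by (simp only: linear_diff[OF lin[OF smooth(1) that]] linear_scale[OF lin[OF smooth(1) that]] real_scaleR_def)
    ultimately show ?thesis
      using hor[OF that, of a] D_f[OF that] D_r_vert[OF that] euler0[OF that] by (simp add: algebra_simps)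
  qed
  \<comment> \<open>At a = y the Euler identities of f0 and P make the two terms on the right equal
    to 2 r P f0 each.\<close>
  have D_r_radial: "D r z (snd z, 0) = 4 * (r z * P z)" if "z \<in> \<Omega>" for z
  proof -
    have "f\<^sub>0 z * D r z (snd z, 0) = f\<^sub>0 z * (4 * (r z * P z))"
      using conformal[OF that, of "snd z"] euler0[OF that] eulerP[OF that] by (simp add: algebra_simps)
    then show ?thesis using f\<^sub>0_nonzero[OF that] by simp
  qed
  have mixed: "D (\<lambda>x. D r x (c, 0)) z (0, a) = 0" if "z \<in> \<Omega>" for z a c
    unfolding D_D_commute[OF \<Omega> smooth_r that, of "(c, 0)"] by (rule D_zero_on[OF \<Omega> that D_r_vert])
  \<comment> \<open>Vertical derivative of \<open>D_r_radial\<close>: on the left the derivative of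
    r_x drops out by \<open>mixed\<close>, and the derivative of its argument y leaves
    r_x(a).\<close>
  have D_r_hor: "D r z (a, 0) = 4 * (r z * D P z (0, a))" if "z \<in> \<Omega>" for z a
  proof -
    have "D (\<lambda>x. D r x (snd x, 0)) z (0, a) = D (\<lambda>x. 4 * (r x * P x)) z (0, a)"
      using D_cong[OF \<Omega> that, of "\<lambda>x. D r x (snd x, 0)" "\<lambda>x. 4 * (r x * P x)"] D_r_radial by simp
    also have "\<dots> = 4 * (r z * D P z (0, a))"
      using D_eqI[OF has_derivative_mult_right[OF has_derivative_mult[OF has_derivative_D[OF diff[OF smooth_r that]]
        has_derivative_D[OF diff[OF smooth(3) that]]]], of 4] D_r_vert[OF that] by simp
    finally show ?thesis
      using D_D_apply[OF \<Omega> smooth_r that linear_differentiable[OF linear_turn], of "(0, a)"] mixed[OF that]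
      by (simp add: D_linear[OF linear_turn])
  qed
  \<comment> \<open>Eliminate r_x(a) between \<open>conformal\<close> and \<open>D_r_hor\<close>,
    then cancel r.\<close>
  have funk: "2 * f\<^sub>0 z * D P z (0, a) = P z * D f\<^sub>0 z (0, a)" if "z \<in> \<Omega>" for z a
  proof -
    have "r z * (2 * f\<^sub>0 z * D P z (0, a)) = r z * (P z * D f\<^sub>0 z (0, a))"
      using conformal[OF that, of a] D_r_hor[OF that, of a] by (simp add: algebra_simps)
    then show ?thesis using r_nonzero[OF that] by simp
  qed
  \<comment> \<open>Another vertical derivative, now of \<open>D_r_hor\<close>; its left side is
    constant along the fibre by \<open>mixed\<close>. So P is linear on the fibre.\<close>
  have D2_P: "D (\<lambda>x. D P x (0, a)) z (0, b) = 0" if "z \<in> \<Omega>" for z a b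
  proof -
    have "D (\<lambda>x. 4 * (r x * D P x (0, a))) z (0, b) = 0"
      unfolding mixed[OF that, of a b, symmetric]
      by (rule fun_cong[OF D_cong[OF \<Omega> that]]) (simp add: D_r_hor)
    moreover have "D (\<lambda>x. 4 * (r x * D P x (0, a))) z (0, b) = 4 * (r z * D (\<lambda>x. D P x (0, a)) z (0, b))"
      using D_eqI[OF has_derivative_mult_right[OF has_derivative_mult[OF has_derivative_D[OF diff[OF smooth_r that]]
        has_derivative_D[OF diff[OF smooth_on_D[OF smooth(3)] that]]]], of 4] D_r_vert[OF that] by simp
    ultimately show ?thesis using r_nonzero[OF that] by simp
  qed
  obtain x y where xy: "z = (x, y)" "x \<in> V" "y \<noteq> 0" using z by (auto simp: \<Omega>_def)
  have const: "D P (x, y') (0, a) = D P z (0, a)" if "y' \<noteq> 0" for y' a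
    unfolding xy(1)
    by (rule fibrewise_constant[OF dim _ _ that xy(3), where g = "\<lambda>z. D P z (0, a)"])
       (use xy(2) in \<open>auto simp: \<Omega>_def intro!: diff smooth_on_D smooth(3) D2_P\<close>)
  have "linear (\<lambda>a. D P z (0, a))"
    using lin[OF smooth(3) z] by (auto simp: linear_iff dest: spec[of _ "(0, _)"])
       (metis add_0 add_Pair scaleR_Pair scaleR_zero_right)+
  \<comment> \<open>Here \<open>y'\<close> is a zero of the linear form d_J P. By
    \<open>const\<close> and the Euler identity P vanishes at (x,y'), so \<open>funk\<close> gives
    d_J P = 0 there, and by \<open>const\<close> also at \<open>z\<close>.\<close>
  then obtain y' where y': "y' \<noteq> 0" "D P z (0, y') = 0"
    using linear_functional_kernel dim by blast
  have z': "(x, y') \<in> \<Omega>" using xy y' by (simp add: \<Omega>_def)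
  then have "P (x, y') = 0" using eulerP[OF z'] const y' by simp
  then have "D P z (0, a) = 0" for a
    using funk[OF z', of a] f\<^sub>0_nonzero[OF z'] const[OF y'(1), of a] by simp
  then show ?thesis using eulerP[OF z] by simp
qed

section \<open>Vector fields on a manifold\<close>

lemma transition_chart: "inj_on (snd c) (fst c) \<Longrightarrow> p \<in> fst c \<Longrightarrow> transition c d (snd c p) = snd d p"
  by (simp add: transition_def chart_inv_def)

lemma D_compose:
  assumes "f differentiable at z" "g differentiable at (f z)"
  shows "D (\<lambda>x. g (f x)) z v = D g (f z) (D f z v)"
  using D_eqI[OF diff_chain_at[OF assms[THEN has_derivative_D]]] by (simp add: o_def)

text \<open>The tangent vector at \<open>p\<close> with component \<open>w\<close> in the chart
  \<open>c\<close>; the value 0 off the charts at \<open>p\<close> follows the convention of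
  \<open>tangent_space\<close>. For fixed \<open>w\<close> and varying \<open>p\<close> this is a
  coordinate vector field.\<close>

definition chart_tvec ::
    "('p, 'e::euclidean_space) chart set \<Rightarrow> ('p, 'e) chart \<Rightarrow> 'p \<Rightarrow> 'e \<Rightarrow> ('p, 'e) tvec" where
  "chart_tvec A c p w = (\<lambda>d. if d \<in> charts_at A p then D (transition c d) (snd c p) w else 0)"

locale atlas =
  fixes A :: "('p, 'e::euclidean_space) chart set"
  assumes smooth_atlas: "smooth_atlas A"
begin

lemma chart_inj: "c \<in> A \<Longrightarrow> inj_on (snd c) (fst c)"
  using smooth_atlas by (auto simp: smooth_atlas_def)

lemma open_overlap: "c \<in> A \<Longrightarrow> d \<in> A \<Longrightarrow> open (snd c ` (fst c \<inter> fst d))"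
  using smooth_atlas by (auto simp: smooth_atlas_def)

lemma smooth_transition: "c \<in> A \<Longrightarrow> d \<in> A \<Longrightarrow> smooth_on (transition c d) (snd c ` (fst c \<inter> fst d))"
  using smooth_atlas by (auto simp: smooth_atlas_def)

lemma open_chart_image: "c \<in> A \<Longrightarrow> open (snd c ` fst c)"
  using open_overlap[of c c] by simp

lemma chart_inv_chart: "c \<in> A \<Longrightarrow> p \<in> fst c \<Longrightarrow> chart_inv c (snd c p) = p"
  by (simp add: chart_inv_def chart_inj)

lemma chart_chart_inv:
  assumes "z \<in> snd c ` fst c"
  shows "snd c (chart_inv c z) = z" "chart_inv c z \<in> fst c"
  using assms by (auto simp: chart_inv_def f_inv_into_f inv_into_into)

lemma transition_differentiable:
  "c \<in> A \<Longrightarrow> d \<in> A \<Longrightarrow> p \<in> fst c \<Longrightarrow> p \<in> fst d \<Longrightarrow> transition c d differentiable at (snd c p)"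
  by (rule smooth_on_differentiable[OF smooth_transition open_overlap]) auto

lemma transition_eq: "c \<in> A \<Longrightarrow> p \<in> fst c \<Longrightarrow> transition c d (snd c p) = snd d p"
  by (rule transition_chart[OF chart_inj])

lemma D_transition_same:
  assumes "c \<in> A" "p \<in> fst c"
  shows "D (transition c c) (snd c p) w = w"
proof -
  have "D (transition c c) (snd c p) = D (\<lambda>x. x) (snd c p)"
    by (rule D_cong[OF open_chart_image[OF assms(1)]])
       (use assms in \<open>auto simp: transition_eq\<close>)
  then show ?thesis by simp
qed

text \<open>The cocycle rule for Jacobians, which makes the components of \<open>chart_tvec\<close>
  compatible.\<close>

lemma D_transition_trans:
  assumes "c \<in> A" "d \<in> A" "e \<in> A" "p \<in> fst c" "p \<in> fst d" "p \<in> fst e"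
  shows "D (transition c e) (snd c p) w = D (transition d e) (snd d p) (D (transition c d) (snd c p) w)"
proof -
  let ?O = "snd c ` (fst c \<inter> fst d) \<inter> snd c ` (fst c \<inter> fst e)"
  have "D (transition c e) (snd c p) = D (\<lambda>x. transition d e (transition c d x)) (snd c p)"
  proof (rule D_cong[of ?O])
    show "open ?O" using assms open_overlap by blast
    show "snd c p \<in> ?O" using assms by blast
    show "transition c e x = transition d e (transition c d x)" if "x \<in> ?O" for x
      using that assms(1-3) chart_inj[OF assms(1)]
      by (auto simp: transition_eq dest!: inj_onD)
  qed
  then show ?thesis
    using D_compose[of "transition c d" "snd c p" "transition d e" w]
      transition_differentiable assms transition_eq by simp
qed

lemma chart_tvec_tangent:
  assumes "c \<in> A" "p \<in> fst c"
  shows "chart_tvec A c p w \<in> tangent_space A p"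
  unfolding tangent_space_def
proof (intro CollectI conjI ballI allI impI)
  fix d e assume "d \<in> charts_at A p" "e \<in> charts_at A p"
  then show "chart_tvec A c p w e = D (transition d e) (snd d p) (chart_tvec A c p w d)"
    using D_transition_trans[OF assms(1) _ _ assms(2), of d e w] by (simp add: chart_tvec_def charts_at_def)
qed (simp add: chart_tvec_def)

lemma chart_tvec_same: "c \<in> A \<Longrightarrow> p \<in> fst c \<Longrightarrow> chart_tvec A c p w c = w"
  by (simp add: chart_tvec_def charts_at_def D_transition_same)

lemma tangent_component:
  assumes "v \<in> tangent_space A p" "c \<in> A" "d \<in> A" "p \<in> fst c" "p \<in> fst d"
  shows "v d = D (transition c d) (snd c p) (v c)"
  using assms unfolding tangent_space_def charts_at_def by blast

lemma tangent_eq_chart_tvec: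
  assumes "v \<in> tangent_space A p" "c \<in> A" "p \<in> fst c"
  shows "v = chart_tvec A c p (v c)"
proof
  fix d
  have "v d = 0" if "d \<notin> charts_at A p" using assms(1) that unfolding tangent_space_def by blast
  then show "v d = chart_tvec A c p (v c) d"
    using tangent_component[OF assms(1,2) _ assms(3), of d]
    by (cases "d \<in> charts_at A p") (auto simp: charts_at_def chart_tvec_def)
qed

lemma chart_tvec_scaleR:
  assumes "c \<in> A" "p \<in> fst c"
  shows "chart_tvec A c p (t *\<^sub>R w) = (\<lambda>d. t *\<^sub>R chart_tvec A c p w d)"
proof
  show "chart_tvec A c p (t *\<^sub>R w) d = t *\<^sub>R chart_tvec A c p w d" for d
    using assms linear_scale[OF linear_D[OF transition_differentiable[of c d]]]
    by (simp add: chart_tvec_def charts_at_def)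
qed

text \<open>Because of this, removing the zero section amounts to y being nonzero in every induced
  chart.\<close>

lemma tangent_zero_iff:
  assumes "v \<in> tangent_space A p" "c \<in> A" "p \<in> fst c"
  shows "v = (\<lambda>_. 0) \<longleftrightarrow> v c = 0"
  using tangent_eq_chart_tvec[OF assms] chart_tvec_scaleR[OF assms(2,3), of 0] by auto

section \<open>Vector fields, their action on functions and their brackets\<close>

lemma openin_chart: "c \<in> A \<Longrightarrow> openin (atlas_topology A) (fst c)"
  unfolding openin_atlas_topology[OF smooth_atlas]
  using open_overlap by (auto simp: points_def Int_commute)

text \<open>Supplies the local fields on which identities between forms are tested. In another chart
  \<open>d\<close> the component at \<open>z\<close> is the Jacobian of the transition map, taken at
  the preimage of \<open>z\<close> and applied to \<open>w\<close>.\<close>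

lemma vector_field_chart_tvec:
  assumes c: "c \<in> A"
  shows "vector_field_on A (fst c) (\<lambda>p. chart_tvec A c p w)"
  unfolding vector_field_on_def
proof (intro conjI ballI)
  show "openin (atlas_topology A) (fst c)" using openin_chart[OF c] .
  show "chart_tvec A c p w \<in> tangent_space A p" if "p \<in> fst c" for p
    using chart_tvec_tangent[OF c that] .
next
  fix d assume d: "d \<in> A"
  have T: "open (snd d ` (fst d \<inter> fst c))" and S: "open (snd c ` (fst c \<inter> fst d))"
    using open_overlap c d by auto
  have "smooth_on (\<lambda>z. D (transition c d) (transition d c z) w) (snd d ` (fst d \<inter> fst c))"
    by (rule smooth_on_D_apply[OF S T _ smooth_transition[OF c d] smooth_transition[OF d c] smooth_on_const])
       (use d in \<open>auto simp: transition_eq\<close>)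
  moreover have "D (transition c d) (transition d c z) w = chart_tvec A c (chart_inv d z) w d"
    if "z \<in> snd d ` (fst d \<inter> fst c)" for z
    using that d by (auto simp: transition_eq chart_inv_chart chart_tvec_def charts_at_def)
  ultimately show "smooth_on (\<lambda>z. chart_tvec A c (chart_inv d z) w d) (snd d ` (fst c \<inter> fst d))"
    using smooth_on_cong[OF T] by (metis (no_types, lifting) Int_commute)
qed

text \<open>Frees \<open>vf_apply\<close> from its arbitrary choice of a chart: by the chain rule
  every chart at the point gives the same value.\<close>

lemma vf_apply_chart:
  assumes c: "c \<in> A" "p \<in> fst c" and X: "X p \<in> tangent_space A p"
    and f: "(f \<circ> chart_inv c) differentiable at (snd c p)"
  shows "vf_apply A X f p = D (f \<circ> chart_inv c) (snd c p) (X p c)"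
proof -
  define e where "e = (SOME c. c \<in> charts_at A p)"
  have "e \<in> charts_at A p"
    unfolding e_def by (rule someI[of _ c]) (use c in \<open>simp add: charts_at_def\<close>)
  then have e: "e \<in> A" "p \<in> fst e" by (auto simp: charts_at_def)
  have "vf_apply A X f p = D (f \<circ> chart_inv e) (snd e p) (X p e)"
    by (simp add: vf_apply_def e_def Let_def)
  also have "D (f \<circ> chart_inv e) (snd e p) = D (\<lambda>x. (f \<circ> chart_inv c) (transition e c x)) (snd e p)"
    by (rule D_cong[OF open_overlap[OF e(1) c(1)]])
       (use c e in \<open>auto simp: transition_eq chart_inv_chart\<close>)
  also have "\<dots> (X p e) = D (f \<circ> chart_inv c) (snd c p) (D (transition e c) (snd e p) (X p e))"
    using D_compose[of "transition e c" "snd e p" "f \<circ> chart_inv c" "X p e"]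
      transition_differentiable transition_eq c e f by simp
  also have "D (transition e c) (snd e p) (X p e) = X p c"
    by (rule tangent_component[OF X e(1) c(1) e(2) c(2), symmetric])
  finally show ?thesis .
qed

lemma open_vf_domain: "vector_field_on A W X \<Longrightarrow> c \<in> A \<Longrightarrow> open (snd c ` (W \<inter> fst c))"
  by (auto simp: vector_field_on_def openin_atlas_topology[OF smooth_atlas])

lemma smooth_vf: "vector_field_on A W X \<Longrightarrow> c \<in> A \<Longrightarrow> smooth_on (\<lambda>z. X (chart_inv c z) c) (snd c ` (W \<inter> fst c))"
  by (auto simp: vector_field_on_def)

lemma vf_tangent: "vector_field_on A W X \<Longrightarrow> p \<in> W \<Longrightarrow> X p \<in> tangent_space A p"
  by (auto simp: vector_field_on_def)

text \<open>Differentiate the transformation law of the components of \<open>Y\<close>, using the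
  chain rule on one side and the product rule on the other. The second derivative of the transition
  map measures how far the derivative of components is from being tensorial.\<close>

lemma D_vf_transition:
  assumes Y: "vector_field_on A W Y" and p: "p \<in> W" "p \<in> fst c" "p \<in> fst d" and cd: "c \<in> A" "d \<in> A"
  shows "D (\<lambda>z. Y (chart_inv d z) d) (snd d p) (D (transition c d) (snd c p) v)
       = D (\<lambda>z. D (transition c d) z (Y p c)) (snd c p) v
         + D (transition c d) (snd c p) (D (\<lambda>z. Y (chart_inv c z) c) (snd c p) v)"
proof -
  let ?\<tau> = "transition c d" and ?Yc = "\<lambda>z. Y (chart_inv c z) c" and ?Yd = "\<lambda>z. Y (chart_inv d z) d"
  let ?O = "snd c ` (W \<inter> fst c) \<inter> snd c ` (fst c \<inter> fst d)"
  have dYc: "?Yc differentiable at (snd c p)"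
    by (rule smooth_on_differentiable[OF smooth_vf[OF Y cd(1)] open_vf_domain[OF Y cd(1)]])
       (use p in blast)
  have dYd: "?Yd differentiable at (snd d p)"
    by (rule smooth_on_differentiable[OF smooth_vf[OF Y cd(2)] open_vf_domain[OF Y cd(2)]])
       (use p in blast)
  have "D (\<lambda>z. ?Yd (?\<tau> z)) (snd c p) = D (\<lambda>z. D ?\<tau> z (?Yc z)) (snd c p)"
  proof (rule D_cong[of ?O])
    show "open ?O" using open_vf_domain[OF Y] open_overlap cd by blast
    show "snd c p \<in> ?O" using p by blast
    show "?Yd (?\<tau> z) = D ?\<tau> z (?Yc z)" if z: "z \<in> ?O" for z
    proof -
      obtain q where q: "q \<in> W" "q \<in> fst c" "q \<in> fst d" "z = snd c q"
        using z chart_inj[OF cd(1)] by (auto dest: inj_onD)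
      show ?thesis
        using tangent_component[OF vf_tangent[OF Y q(1)] cd q(2,3)] q
        by (simp add: cd transition_eq chart_inv_chart)
    qed
  qed
  moreover have "D (\<lambda>z. ?Yd (?\<tau> z)) (snd c p) v = D ?Yd (snd d p) (D ?\<tau> (snd c p) v)"
    using D_compose[of ?\<tau> "snd c p" ?Yd v] transition_differentiable[OF cd p(2,3)] dYd
    by (simp add: transition_eq[OF cd(1) p(2)])
  moreover have "D (\<lambda>z. D ?\<tau> z (?Yc z)) (snd c p) v
      = D (\<lambda>z. D ?\<tau> z (Y p c)) (snd c p) v + D ?\<tau> (snd c p) (D ?Yc (snd c p) v)"
    using D_D_apply[OF open_overlap[OF cd] smooth_transition[OF cd] _ dYc] p cd
    by (simp add: chart_inv_chart)
  ultimately show ?thesis by simp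
qed

text \<open>The second-derivative terms of \<open>D_vf_transition\<close> for X and Y are equal by
  symmetry and cancel in the bracket.\<close>

lemma lie_bracket_tangent:
  assumes X: "vector_field_on A W X" and Y: "vector_field_on A W Y" and p: "p \<in> W"
  shows "lie_bracket A X Y p \<in> tangent_space A p"
  unfolding tangent_space_def
proof (intro CollectI conjI ballI allI impI)
  show "lie_bracket A X Y p c = 0" if "c \<notin> charts_at A p" for c
    using that by (simp add: lie_bracket_def)
next
  fix c d assume "c \<in> charts_at A p" "d \<in> charts_at A p"
  then have cd: "c \<in> A" "d \<in> A" and pc: "p \<in> fst c" and pd: "p \<in> fst d" by (auto simp: charts_at_def)
  let ?\<tau> = "transition c d"
  have Xd: "X p d = D ?\<tau> (snd c p) (X p c)" and Yd: "Y p d = D ?\<tau> (snd c p) (Y p c)"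
    using tangent_component vf_tangent X Y p cd pc pd by blast+
  have "D (\<lambda>z. D ?\<tau> z (Y p c)) (snd c p) (X p c) = D (\<lambda>z. D ?\<tau> z (X p c)) (snd c p) (Y p c)"
    using D_D_commute[OF open_overlap[OF cd] smooth_transition[OF cd]] pc pd by blast
  then show "lie_bracket A X Y p d = D ?\<tau> (snd c p) (lie_bracket A X Y p c)"
    using \<open>c \<in> charts_at A p\<close> \<open>d \<in> charts_at A p\<close>
      linear_diff[OF linear_D[OF transition_differentiable[OF cd pc pd]]]
    unfolding lie_bracket_def
    by (simp add: Xd Yd D_vf_transition[OF X p pc pd cd] D_vf_transition[OF Y p pc pd cd])
qed

end

section \<open>Charts of the slit tangent bundle\<close>

locale base_manifold = atlas M for M :: "('m, 'e::euclidean_space) chart set"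
begin

lemma T0M_chart_inj:
  assumes "c \<in> M"
  shows "inj_on (snd (T0M_chart M c)) (fst (T0M_chart M c))"
proof (rule inj_onI)
  fix u u' assume u: "u \<in> fst (T0M_chart M c)" "u' \<in> fst (T0M_chart M c)"
    and eq: "snd (T0M_chart M c) u = snd (T0M_chart M c) u'"
  obtain p v q w where pq: "u = (p, v)" "u' = (q, w)" by (metis prod.collapse)
  have p: "p \<in> fst c" "v \<in> tangent_space M p" and q: "q \<in> fst c" "w \<in> tangent_space M q"
    and e: "snd c p = snd c q" "v c = w c"
    using u eq by (auto simp: T0M_chart_def pq)
  have "p = q" using inj_onD[OF chart_inj[OF assms] e(1) p(1) q(1)] .
  moreover have "v = w"
    using tangent_eq_chart_tvec[OF p(2) assms p(1)] tangent_eq_chart_tvec[OF q(2) assms q(1)] e \<open>p = q\<close>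
    by metis
  ultimately show "u = u'" by (simp add: pq)
qed

lemma chart_tvec_nonzero:
  assumes "c \<in> M" "p \<in> fst c" "y \<noteq> 0"
  shows "chart_tvec M c p y \<noteq> (\<lambda>_. 0)"
  using tangent_zero_iff[OF chart_tvec_tangent[OF assms(1,2)] assms(1,2)] chart_tvec_same assms by simp

lemma T0M_chart_mem:
  assumes "c \<in> M" "p \<in> fst c" "y \<noteq> 0"
  shows "(p, chart_tvec M c p y) \<in> fst (T0M_chart M c)"
    and "snd (T0M_chart M c) (p, chart_tvec M c p y) = (snd c p, y)"
  using assms chart_tvec_nonzero[OF assms] chart_tvec_tangent[OF assms(1,2)] chart_tvec_same[OF assms(1,2)]
  by (auto simp: T0M_chart_def)

lemma T0M_overlap:
  assumes c: "c \<in> M" and d: "d \<in> M"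
  shows "snd (T0M_chart M c) ` (fst (T0M_chart M c) \<inter> fst (T0M_chart M d))
       = snd c ` (fst c \<inter> fst d) \<times> (- {0::'e})"
proof
  show "snd (T0M_chart M c) ` (fst (T0M_chart M c) \<inter> fst (T0M_chart M d))
       \<subseteq> snd c ` (fst c \<inter> fst d) \<times> (- {0::'e})"
    using tangent_zero_iff[OF _ c] by (auto simp: T0M_chart_def)
  show "snd c ` (fst c \<inter> fst d) \<times> (- {0::'e})
       \<subseteq> snd (T0M_chart M c) ` (fst (T0M_chart M c) \<inter> fst (T0M_chart M d))"
  proof
    fix z assume "z \<in> snd c ` (fst c \<inter> fst d) \<times> (- {0::'e})"
    then obtain p y where py: "z = (snd c p, y)" "p \<in> fst c" "p \<in> fst d" "y \<noteq> 0" by auto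
    have "(p, chart_tvec M c p y) \<in> fst (T0M_chart M d)"
      using T0M_chart_mem(1)[OF c py(2,4)] py(3) by (auto simp: T0M_chart_def)
    then show "z \<in> snd (T0M_chart M c) ` (fst (T0M_chart M c) \<inter> fst (T0M_chart M d))"
      using T0M_chart_mem[OF c py(2,4)] py(1) by (metis IntI imageI)
  qed
qed

lemma chart_inv_T0M:
  assumes "c \<in> M" "p \<in> fst c" "y \<noteq> 0"
  shows "chart_inv (T0M_chart M c) (snd c p, y) = (p, chart_tvec M c p y)"
  unfolding chart_inv_def
  by (rule inv_into_f_eq[OF T0M_chart_inj[OF assms(1)] T0M_chart_mem[OF assms]])

lemma transition_T0M:
  assumes c: "c \<in> M" and d: "d \<in> M" and z: "z \<in> snd c ` (fst c \<inter> fst d) \<times> (- {0})"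
  shows "transition (T0M_chart M c) (T0M_chart M d) z
       = (transition c d (fst z), D (transition c d) (fst z) (snd z))"
proof -
  obtain p y where py: "z = (snd c p, y)" "p \<in> fst c" "p \<in> fst d" "y \<noteq> 0" using z by auto
  have "transition (T0M_chart M c) (T0M_chart M d) z = snd (T0M_chart M d) (p, chart_tvec M c p y)"
    using chart_inv_T0M[OF c py(2,4)] by (simp add: transition_def py(1))
  then show ?thesis
    using c d py by (simp add: T0M_chart_def transition_eq chart_tvec_def charts_at_def)
qed

lemma open_T0M_overlap: "c \<in> M \<Longrightarrow> d \<in> M \<Longrightarrow> open (snd c ` (fst c \<inter> fst d) \<times> (- {0::'e}))"
  by (simp add: open_Times open_overlap open_Compl)

lemma smooth_T0M_transition:
  assumes c: "c \<in> M" and d: "d \<in> M"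
  shows "smooth_on (transition (T0M_chart M c) (T0M_chart M d)) (snd c ` (fst c \<inter> fst d) \<times> (- {0}))"
proof -
  let ?W = "snd c ` (fst c \<inter> fst d)"
  have O: "open (?W \<times> (- {0::'e}))" using open_T0M_overlap[OF c d] .
  have f: "smooth_on fst (?W \<times> (- {0::'e}))" and s: "smooth_on snd (?W \<times> (- {0::'e}))"
    by (auto intro: smooth_on_linear linear_fst linear_snd)
  have "fst ` (?W \<times> (- {0::'e})) \<subseteq> ?W" by auto
  then have "smooth_on (\<lambda>z. (transition c d (fst z), D (transition c d) (fst z) (snd z))) (?W \<times> (- {0}))"
    by (intro smooth_on_Pair O smooth_on_compose[OF O open_overlap[OF c d] _ f smooth_transition[OF c d]]
        smooth_on_D_apply[OF open_overlap[OF c d] O _ smooth_transition[OF c d] f s])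
  then show ?thesis
    using smooth_on_cong[OF O] transition_T0M[OF c d] by (metis (no_types, lifting))
qed

lemma smooth_atlas_T0M: "smooth_atlas (T0M M)"
  unfolding smooth_atlas_def T0M_def
  using T0M_chart_inj T0M_overlap open_T0M_overlap smooth_T0M_transition by auto

sublocale T: atlas "T0M M"
  by unfold_locales (rule smooth_atlas_T0M)

lemma T0M_chart_in: "c \<in> M \<Longrightarrow> T0M_chart M c \<in> T0M M"
  by (simp add: T0M_def)

lemma T0M_image: "c \<in> M \<Longrightarrow> snd (T0M_chart M c) ` fst (T0M_chart M c) = snd c ` fst c \<times> (- {0})"
  using T0M_overlap[of c c] by simp

text \<open>The Jacobian of an induced transition map is block triangular with twice the same
  diagonal block, the Jacobian of the base transition.\<close>

lemma D_T0M_transition: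
  assumes c: "c \<in> M" and d: "d \<in> M"
    and u: "u \<in> fst (T0M_chart M c)" "u \<in> fst (T0M_chart M d)"
  defines "T \<equiv> D (transition (T0M_chart M c) (T0M_chart M d)) (snd (T0M_chart M c) u)"
  shows "fst (T v) = D (transition c d) (snd c (fst u)) (fst v)"
    and "T (0, b) = (0, D (transition c d) (snd c (fst u)) b)"
proof -
  let ?O = "snd c ` (fst c \<inter> fst d) \<times> (- {0::'e})" and ?\<tau> = "transition c d"
    and ?T = "transition (T0M_chart M c) (T0M_chart M d)"
  obtain p y where z: "snd (T0M_chart M c) u = (snd c p, y)" and p: "p \<in> fst c" "p \<in> fst d" "fst u = p"
    and y: "y \<noteq> 0"
    using u tangent_zero_iff[OF _ c] by (auto simp: T0M_chart_def)
  have O: "open ?O" using open_T0M_overlap[OF c d] .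
  have zO: "(snd c p, y) \<in> ?O" using p y by auto
  have dT: "?T differentiable at (snd c p, y)"
    by (rule smooth_on_differentiable[OF smooth_T0M_transition[OF c d] O zO])
  have d\<tau>: "?\<tau> differentiable at (snd c p)" using transition_differentiable c d p by blast
  have "fst (T v) = D (\<lambda>z. fst (?T z)) (snd c p, y) v"
    unfolding T_def z using D_fst[OF dT] by simp
  also have "\<dots> = D (\<lambda>z. ?\<tau> (fst z)) (snd c p, y) v"
    by (rule fun_cong[OF D_cong[OF O zO]]) (simp add: transition_T0M[OF c d])
  also have "\<dots> = D ?\<tau> (snd c p) (fst v)"
    using D_compose[of fst "(snd c p, y)" ?\<tau> v] d\<tau> linear_differentiable[OF linear_fst, of "(snd c p, y)"]
    by (simp add: D_linear[OF linear_fst])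
  finally show "fst (T v) = D ?\<tau> (snd c (fst u)) (fst v)" using p by simp
  \<comment> \<open>Along a fibre the base part of the transition map is constant and the fibre part
    linear, so the vertical derivative can be read off.\<close>
  have curve: "((\<lambda>y. (snd c p, y)) has_derivative (\<lambda>b. (0, b))) (at y)"
    by (auto intro!: derivative_eq_intros)
  then have "T (0, b) = D (\<lambda>y. ?T (snd c p, y)) y b"
    using D_compose[of "\<lambda>y. (snd c p, y)" y ?T b] dT D_eqI[OF curve] differentiableI
    unfolding T_def z by auto
  also have "\<dots> = D (\<lambda>y. (?\<tau> (snd c p), D ?\<tau> (snd c p) y)) y b"
    by (rule fun_cong[OF D_cong[of "- {0}"]]) (use p y in \<open>auto simp: open_Compl transition_T0M[OF c d]\<close>)
  also have "\<dots> = (0, D ?\<tau> (snd c p) b)"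
  proof -
    have "(D ?\<tau> (snd c p) has_derivative D ?\<tau> (snd c p)) (at y)"
      using linear_D[OF d\<tau>] by (simp add: bounded_linear_imp_has_derivative linear_linear)
    then have "((\<lambda>y. (?\<tau> (snd c p), D ?\<tau> (snd c p) y)) has_derivative (\<lambda>b. (0, D ?\<tau> (snd c p) b))) (at y)"
      by (intro has_derivative_Pair has_derivative_const)
    from fun_cong[OF D_eqI[OF this]] show ?thesis .
  qed
  finally show "T (0, b) = (0, D ?\<tau> (snd c (fst u)) b)" using p by simp
qed

text \<open>Both diagonal blocks of the induced Jacobian agree, so moving the x-components into the
  y-slot commutes with the change of charts.\<close>

lemma tan_J_tangent:
  assumes "Y u \<in> tangent_space (T0M M) u"
  shows "tan_J Y u \<in> tangent_space (T0M M) u"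
  unfolding tangent_space_def
proof (intro CollectI conjI ballI allI impI)
  fix C assume "C \<notin> charts_at (T0M M) u"
  then have "Y u C = 0" using assms unfolding tangent_space_def by blast
  then show "tan_J Y u C = 0" by (simp add: tan_J_def zero_prod_def)
next
  fix C C' assume "C \<in> charts_at (T0M M) u" "C' \<in> charts_at (T0M M) u"
  then obtain c d where cd: "c \<in> M" "d \<in> M" "C = T0M_chart M c" "C' = T0M_chart M d"
    "u \<in> fst C" "u \<in> fst C'"
    by (auto simp: charts_at_def T0M_def)
  have "Y u C' = D (transition C C') (snd C u) (Y u C)"
    using T.tangent_component[OF assms] cd T0M_chart_in by blast
  then show "tan_J Y u C' = D (transition C C') (snd C u) (tan_J Y u C)"
    using D_T0M_transition[OF cd(1,2)] cd(3-6) by (simp add: tan_J_def)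
qed

lemma scale_chart_inv:
  assumes c: "c \<in> M" and z: "z \<in> snd c ` fst c \<times> (- {0})" and t: "t \<noteq> 0"
  shows "chart_inv (T0M_chart M c) (fst z, t *\<^sub>R snd z) = fiber_scale t (chart_inv (T0M_chart M c) z)"
proof -
  obtain p y where z: "z = (snd c p, y)" and p: "p \<in> fst c" and y: "y \<noteq> 0" using z by auto
  show ?thesis
    using chart_inv_T0M[OF c p y] chart_inv_T0M[OF c p, of "t *\<^sub>R y"] t y
      chart_tvec_scaleR[OF c p] by (simp add: z fiber_scale_def)
qed

lemma T0M_points: "u \<in> points (T0M M) \<longleftrightarrow> (\<exists>c\<in>M. u \<in> fst (T0M_chart M c))"
  by (auto simp: points_def T0M_def)

lemma points_T0M_TM:
  assumes "u \<in> points (T0M M)"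
  shows "u \<in> points (TM M)" "snd u \<noteq> (\<lambda>_. 0)"
  using assms by (auto simp: points_def T0M_def TM_def T0M_chart_def TM_chart_def)

end

section \<open>Local representatives in one induced chart\<close>

locale T0M_chart_at = base_manifold M for M :: "('m, 'e::euclidean_space) chart set" +
  fixes c assumes c: "c \<in> M"
begin

abbreviation "C \<equiv> T0M_chart M c"
abbreviation "V \<equiv> snd c ` fst c"
abbreviation "\<Omega> \<equiv> V \<times> (- {0::'e})"
abbreviation "loc f \<equiv> (\<lambda>z. f (chart_inv C z))"

lemma C: "C \<in> T0M M" using T0M_chart_in[OF c] .

lemma image_C: "snd C ` fst C = \<Omega>" using T0M_image[OF c] .

lemma open_V: "open V" using open_chart_image[OF c] .

lemma open_\<Omega>: "open \<Omega>" using T.open_chart_image[OF C] image_C by simp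

lemma C_mem: "u \<in> fst C \<Longrightarrow> snd C u \<in> \<Omega>" using image_C by blast

lemma C_inv: "z \<in> \<Omega> \<Longrightarrow> snd C (chart_inv C z) = z" "z \<in> \<Omega> \<Longrightarrow> chart_inv C z \<in> fst C"
  using T.chart_chart_inv[of z C] image_C by auto

lemma inv_points: "z \<in> \<Omega> \<Longrightarrow> chart_inv C z \<in> points (T0M M)"
  using C_inv c T0M_points by blast

lemma smooth_loc: "smooth_fun (T0M M) f \<Longrightarrow> smooth_on (loc f) \<Omega>"
  using C image_C by (auto simp: smooth_fun_def o_def)

lemma charts_at_C: "z \<in> \<Omega> \<Longrightarrow> C \<in> charts_at (T0M M) (chart_inv C z)"
  using C C_inv by (simp add: charts_at_def)

lemma vf_apply_loc:
  assumes "z \<in> \<Omega>" "X (chart_inv C z) \<in> tangent_space (T0M M) (chart_inv C z)" "loc f differentiable at z"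
  shows "vf_apply (T0M M) X f (chart_inv C z) = D (loc f) z (X (chart_inv C z) C)"
  using T.vf_apply_chart[of C "chart_inv C z" X f] assms C C_inv by (simp add: o_def)

text \<open>Both sides are the derivative of g(x, t y) at t = 1, found by the chain rule and by
  homogeneity.\<close>

lemma euler_loc:
  assumes hom: "homogeneous1_on (points (T0M M)) g" and g: "smooth_fun (T0M M) g" and z: "z \<in> \<Omega>"
  shows "D (loc g) z (0, snd z) = loc g z"
proof -
  have dg: "loc g differentiable at z"
    using smooth_on_differentiable[OF smooth_loc[OF g] open_\<Omega> z] .
  have "((\<lambda>t. (fst z, t *\<^sub>R snd z)) has_derivative (\<lambda>t. (0, t *\<^sub>R snd z))) (at 1)"
    by (auto intro!: derivative_eq_intros)
  from diff_chain_at[OF this, of "loc g"] has_derivative_D[OF dg]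
  have 1: "((\<lambda>t. loc g (fst z, t *\<^sub>R snd z)) has_derivative (\<lambda>t. D (loc g) z (0, t *\<^sub>R snd z))) (at 1)"
    by (simp add: o_def)
  have 2: "((\<lambda>t. t * loc g z) has_derivative (\<lambda>t. t * loc g z)) (at 1)"
    by (auto intro!: derivative_eq_intros)
  have "((\<lambda>t. loc g (fst z, t *\<^sub>R snd z)) has_derivative (\<lambda>t. t * loc g z)) (at 1)"
  \<comment> \<open>Homogeneity is available for positive \<open>t\<close> only; these form an open
    set around 1.\<close>
  proof (rule has_derivative_transform_within_open[OF 2, of "{0<..}"])
    show "t * loc g z = loc g (fst z, t *\<^sub>R snd z)" if "t \<in> {0<..}" for t
      using scale_chart_inv[OF c z, of t] hom that inv_points[OF z]
      by (simp add: homogeneous1_on_def)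
  qed auto
  from fun_cong[OF has_derivative_unique[OF 1 this], of 1] show ?thesis by simp
qed

end

section \<open>Sprays and Finsler functions on the slit tangent bundle\<close>

lemma vector_field_on_subset:
  assumes A: "smooth_atlas A" and X: "vector_field_on A W X" and W': "openin (atlas_topology A) W'" "W' \<subseteq> W"
  shows "vector_field_on A W' X"
  unfolding vector_field_on_def
proof (intro conjI ballI)
  fix c assume "c \<in> A"
  then have "smooth_on (\<lambda>z. X (chart_inv c z) c) (snd c ` (W \<inter> fst c))"
    using X by (simp add: vector_field_on_def)
  then show "smooth_on (\<lambda>z. X (chart_inv c z) c) (snd c ` (W' \<inter> fst c))"
    by (rule smooth_on_subset) (use W' in blast)
qed (use X W' in \<open>auto simp: vector_field_on_def\<close>)

context T0M_chart_at
begin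

abbreviation "vloc X \<equiv> (\<lambda>z. X (chart_inv C z) C)"

text \<open>The coordinate field in the base direction \<open>a\<close>. The geodesic equation and
  the Jacobi endomorphism are evaluated on these fields, whose components have zero
  derivative.\<close>

abbreviation "coord a \<equiv> (\<lambda>u. chart_tvec (T0M M) C u (a, 0))"

lemma coord_vector_field: "vector_field_on (T0M M) (fst C) (coord a)"
  using T.vector_field_chart_tvec[OF C] .

lemma vloc_coord: "z \<in> \<Omega> \<Longrightarrow> vloc (coord a) z = (a, 0)"
  using T.chart_tvec_same[OF C] C_inv by simp

lemma D_vloc_coord: "z \<in> \<Omega> \<Longrightarrow> D (vloc (coord a)) z v = 0"
  using D_cong[OF open_\<Omega>, of z "vloc (coord a)" "\<lambda>z. (a, 0)"] vloc_coord by simp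

lemma lie_bracket_loc:
  "z \<in> \<Omega> \<Longrightarrow> lie_bracket (T0M M) X Y (chart_inv C z) C = D (vloc Y) z (vloc X z) - D (vloc X) z (vloc Y z)"
  using charts_at_C[of z] C_inv[of z] by (simp add: lie_bracket_def)

lemma liouville_loc: "z \<in> \<Omega> \<Longrightarrow> liouville M (chart_inv C z) C = (0, snd z)"
  using charts_at_C[of z] C_inv[of z] by (simp add: liouville_def)

lemma d_along_J_loc:
  assumes "z \<in> \<Omega>" "Y (chart_inv C z) \<in> tangent_space (T0M M) (chart_inv C z)" "smooth_fun (T0M M) g"
  shows "d_along (T0M M) tan_J g Y (chart_inv C z) = D (loc g) z (0, fst (vloc Y z))"
  using vf_apply_loc[of z "tan_J Y" g, OF assms(1) tan_J_tangent[of Y, OF assms(2)]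
      smooth_on_differentiable[OF smooth_loc[OF assms(3)] open_\<Omega> assms(1)]]
  by (simp add: d_along_def d0_def tan_J_def)

lemma smooth_fun_square: "smooth_fun (T0M M) F \<Longrightarrow> smooth_fun (T0M M) (\<lambda>u. (F u)\<^sup>2)"
  unfolding smooth_fun_def o_def power2_eq_square
  using T.open_chart_image by (auto intro: smooth_on_mult)

lemma D_square:
  assumes "smooth_fun (T0M M) F" "z \<in> \<Omega>"
  shows "D (loc (\<lambda>u. (F u)\<^sup>2)) z v = 2 * loc F z * D (loc F) z v"
proof -
  have "(loc F has_derivative D (loc F) z) (at z)"
    by (rule has_derivative_D[OF smooth_on_differentiable[OF smooth_loc[OF assms(1)] open_\<Omega> assms(2)]])
  from fun_cong[OF D_eqI[OF has_derivative_power[OF this, of 2]], of v] show ?thesis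
    by (simp add: mult_ac)
qed

lemma euler_square:
  assumes "smooth_fun (T0M M) F" "homogeneous1_on (points (T0M M)) F" "z \<in> \<Omega>"
  shows "D (loc (\<lambda>u. (F u)\<^sup>2)) z (0, snd z) = 2 * loc (\<lambda>u. (F u)\<^sup>2) z"
  using D_square[OF assms(1,3)] euler_loc[OF assms(2,1,3)] by (simp add: power2_eq_square)

section \<open>Horizontal projector, geodesic equation and Jacobi endomorphism in
  coordinates\<close>

context
  fixes S assumes spray: "spray M S"
begin

lemma spray_vector_field: "vector_field_on (T0M M) (fst C) S"
proof (rule vector_field_on_subset[OF smooth_atlas_T0M])
  show "vector_field_on (T0M M) (points (T0M M)) S" using spray by (simp add: spray_def)
  show "openin (atlas_topology (T0M M)) (fst C)" using T.openin_chart[OF C] .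
  show "fst C \<subseteq> points (T0M M)" using C by (auto simp: points_def)
qed

lemma spray_chart: "spray_chart \<Omega> (vloc S)"
proof
  show "open \<Omega>" by (rule open_\<Omega>)
  show "smooth_on (vloc S) \<Omega>"
    using T.smooth_vf[OF spray_vector_field C] image_C by simp
  show "fst (vloc S z) = snd z" if "z \<in> \<Omega>" for z
  proof -
    have "tan_J S (chart_inv C z) C = liouville M (chart_inv C z) C"
      using spray inv_points[OF that] by (simp add: spray_def)
    then show ?thesis using liouville_loc[OF that] by (simp add: tan_J_def)
  qed
qed

interpretation spray_chart \<Omega> "vloc S" by (rule spray_chart)

text \<open>In [S,JY] - J[S,Y] the derivatives of the components of Y cancel. What remains depends
  on the value of Y alone, and subtracting it from Y leaves twice the lift of the
  x-component.\<close>

lemma hor_loc: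
  assumes z: "z \<in> \<Omega>" and Y: "vloc Y differentiable at z"
  shows "hor M S Y (chart_inv C z) C = hlift (vloc S) z (fst (vloc Y z))"
proof -
  let ?s = "vloc S" and ?y = "vloc Y"
  have "D (vloc (tan_J Y)) z v = (0, fst (D ?y z v))" for v
    unfolding tan_J_def
    using fun_cong[OF D_eqI[OF has_derivative_Pair[OF has_derivative_const has_derivative_fst[OF has_derivative_D[OF Y]], of 0]], of v]
    by simp
  then have "lie_vform1 (T0M M) S tan_J Y (chart_inv C z) C
      = (0, fst (D ?y z (?s z))) - D ?s z (0, fst (?y z)) - (0, fst (D ?y z (?s z) - D ?s z (?y z)))"
    using lie_bracket_loc[OF z, of S "tan_J Y"] lie_bracket_loc[OF z, of S Y]
    by (simp add: lie_vform1_def tan_J_def)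
  also have "\<dots> = (0, snd (?y z)) - D ?s z (0, fst (?y z))"
    using fst_D_s[OF z, of "?y z"] by (simp add: prod_eq_iff)
  finally have L: "lie_vform1 (T0M M) S tan_J Y (chart_inv C z) C = (0, snd (?y z)) - D ?s z (0, fst (?y z))" .
  show ?thesis
    using fst_D_s[OF z, of "(0, fst (?y z))"]
    unfolding hor_def hlift_def L by (simp add: prod_eq_iff flip: scaleR_2)
qed

text \<open>Expand dd_J E(S,Y) for the coordinate field Y in the direction \<open>a\<close>. The
  first term is S(E_y(a)). As JS = C, Euler gives d_J E(S) = 2E, so the second term is -2 E_x(a).
  The third vanishes because [S,Y] is vertical. The right side of the geodesic equation is
  -E_x(a).\<close>

lemma geodesic_loc:
  assumes F: "smooth_fun (T0M M) F" "homogeneous1_on (points (T0M M)) F"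
    and geo: "geodesic_spray M F S" and z: "z \<in> \<Omega>"
  shows "D (\<lambda>x. D (loc (\<lambda>u. (F u)\<^sup>2)) x (0, a)) z (vloc S z) = D (loc (\<lambda>u. (F u)\<^sup>2)) z (a, 0)"
proof -
  define E where "E = (\<lambda>u. (F u)\<^sup>2)"
  let ?f = "loc E" and ?u = "chart_inv C z"
  have E: "smooth_fun (T0M M) E" unfolding E_def using smooth_fun_square[OF F(1)] .
  have u: "?u \<in> fst C" using C_inv[OF z] by simp
  have diff: "?f differentiable at z" "(\<lambda>x. D ?f x v) differentiable at z" for v
    using smooth_on_differentiable[OF _ open_\<Omega> z] smooth_loc[OF E] smooth_on_D by blast+
  have tS: "S (chart_inv C x) \<in> tangent_space (T0M M) (chart_inv C x)"
    and tY: "coord a (chart_inv C x) \<in> tangent_space (T0M M) (chart_inv C x)" if "x \<in> \<Omega>" for x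
    using T.vf_tangent spray_vector_field coord_vector_field C_inv that by blast+
  have \<alpha>Y: "loc (d_along (T0M M) tan_J E (coord a)) x = D ?f x (0, a)" if "x \<in> \<Omega>" for x
    using d_along_J_loc[of x "coord a", OF that tY[OF that] E] vloc_coord[OF that] by simp
  have \<alpha>S: "loc (d_along (T0M M) tan_J E S) x = 2 * ?f x" if "x \<in> \<Omega>" for x
    using d_along_J_loc[of x S, OF that tS[OF that] E] fst_s[OF that] euler_square[OF F that]
    by (simp add: E_def)
  have "vf_apply (T0M M) S (d_along (T0M M) tan_J E (coord a)) ?u = D (\<lambda>x. D ?f x (0, a)) z (vloc S z)"
  proof -
    have "loc (d_along (T0M M) tan_J E (coord a)) differentiable at z"
      using has_derivative_transform_within_open[OF has_derivative_D[OF diff(2)] open_\<Omega> z \<alpha>Y[symmetric]]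
      by (rule differentiableI)
    then show ?thesis
      using vf_apply_loc[of z S, OF z tS[OF z]] D_cong[OF open_\<Omega> z \<alpha>Y] by simp
  qed
  moreover have "vf_apply (T0M M) (coord a) (d_along (T0M M) tan_J E S) ?u = 2 * D ?f z (a, 0)"
  proof -
    have d: "((\<lambda>x. 2 * ?f x) has_derivative (\<lambda>v. 2 * D ?f z v)) (at z)"
      by (intro has_derivative_mult_right has_derivative_D diff)
    have "(loc (d_along (T0M M) tan_J E S) has_derivative (\<lambda>v. 2 * D ?f z v)) (at z)"
      by (rule has_derivative_transform_within_open[OF d open_\<Omega> z \<alpha>S[symmetric]])
    then show ?thesis
      using vf_apply_loc[of z "coord a", OF z tY[OF z] differentiableI] D_eqI vloc_coord[OF z] by metis
  qed
  moreover have "d_along (T0M M) tan_J E (lie_bracket (T0M M) S (coord a)) ?u = 0"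
    using d_along_J_loc[of z "lie_bracket (T0M M) S (coord a)", OF z
        T.lie_bracket_tangent[OF spray_vector_field coord_vector_field u] E]
      lie_bracket_loc[OF z, of S "coord a"] D_vloc_coord[OF z] fst_D_s[OF z] vloc_coord[OF z]
      linear_0[OF linear_D[OF diff(1)]]
    by (simp add: zero_prod_def)
  moreover have "d0 (T0M M) E (coord a) ?u = D ?f z (a, 0)"
    unfolding d0_def using vf_apply_loc[of z "coord a", OF z tY[OF z] diff(1)] vloc_coord[OF z] by simp
  moreover have "dd_J_sq M F S (coord a) ?u = - d0 (T0M M) E (coord a) ?u"
    using geo coord_vector_field u unfolding geodesic_spray_def E_def by blast
  ultimately show ?thesis
    unfolding dd_J_sq_def d1_def by (simp add: E_def)
qed

text \<open>For the coordinate field X in the direction \<open>a\<close>, and L = [S,h], one has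
  Phi(X) = L(X) - h L(X) and L(X) = [S,hX] - h[S,X]. All terms are horizontal except [S,hX], which
  annihilates \<open>f\<close> as a bracket.\<close>

lemma jacobi_preserves_energy:
  fixes f :: "'e \<times> 'e \<Rightarrow> real"
  assumes f: "smooth_on f \<Omega>" and euler: "\<And>z. z \<in> \<Omega> \<Longrightarrow> D f z (0, snd z) = 2 * f z"
    and geodesic: "\<And>z a. z \<in> \<Omega> \<Longrightarrow> D (\<lambda>x. D f x (0, a)) z (vloc S z) = D f z (a, 0)"
    and z: "z \<in> \<Omega>"
  shows "D f z (jacobi_endo M S (coord a) (chart_inv C z) C) = 0"
proof -
  let ?s = "vloc S" and ?H = "\<lambda>x. hlift (vloc S) x a"
  let ?L = "lie_vform1 (T0M M) S (hor M S) (coord a)"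
  let ?br = "\<lambda>x. D ?H x (?s x) - D ?s x (?H x)"
  note lin = linear_D[OF smooth_on_differentiable[OF f open_\<Omega> z]]
  note hlift = hlift_preserves_energy[OF f euler geodesic z]
  have smooth_H: "smooth_on ?H \<Omega>" by (rule smooth_hlift)
  have diff_const: "vloc (coord a) differentiable at x" if "x \<in> \<Omega>" for x
    using has_derivative_transform_within_open[OF has_derivative_const open_\<Omega> that vloc_coord[symmetric]]
    by (rule differentiableI)
  have hor_coord: "vloc (hor M S (coord a)) x = ?H x" if "x \<in> \<Omega>" for x
    using hor_loc[of x "coord a", OF that diff_const[OF that]] vloc_coord[OF that] by simp
  have br: "lie_bracket (T0M M) S (hor M S (coord a)) (chart_inv C x) C = ?br x" if "x \<in> \<Omega>" for x
    using lie_bracket_loc[of x S "hor M S (coord a)", OF that] hor_coord[OF that]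
      D_cong[OF open_\<Omega> that hor_coord] by simp
  have b0: "vloc (lie_bracket (T0M M) S (coord a)) x = - D ?s x (a, 0)" if "x \<in> \<Omega>" for x
    using lie_bracket_loc[of x S "coord a", OF that] D_vloc_coord[OF that] vloc_coord[OF that] by simp
  have "vloc (lie_bracket (T0M M) S (coord a)) differentiable at x" if "x \<in> \<Omega>" for x
  proof -
    have "(\<lambda>x. - D ?s x (a, 0)) differentiable at x"
      by (intro differentiable_minus smooth_on_differentiable[OF smooth_on_D[OF smooth_s] open_\<Omega> that])
    from differentiableI[OF has_derivative_transform_within_open[OF has_derivative_D[OF this] open_\<Omega> that b0[symmetric]]]
    show ?thesis .
  qed
  \<comment> \<open>[S,X] is vertical, so its horizontal part is the lift of 0; it stays written as
    a lift so that the fact \<open>hlift\<close> applies.\<close>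
  then have hor_b0: "hor M S (lie_bracket (T0M M) S (coord a)) (chart_inv C x) C = hlift ?s x 0" if "x \<in> \<Omega>" for x
    using hor_loc[OF that] b0[OF that] fst_D_s[OF that] that by simp
  have L: "vloc ?L x = ?br x - hlift ?s x 0" if "x \<in> \<Omega>" for x
    using br[OF that] hor_b0[OF that] by (simp add: lie_vform1_def)
  \<comment> \<open>\<open>hor_loc\<close> asks for differentiable components of the field
    \<open>?L\<close> to which the projector is applied a second time.\<close>
  have "smooth_on (\<lambda>x. ?br x - hlift ?s x 0) \<Omega>"
    by (intro smooth_on_diff open_\<Omega> smooth_hlift
        smooth_on_D_apply[OF open_\<Omega> open_\<Omega>, where k = "\<lambda>x. x"] smooth_H smooth_s
        smooth_on_linear linear_ident) auto
  then have "(\<lambda>x. ?br x - hlift ?s x 0) differentiable at z"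
    by (rule smooth_on_differentiable[OF _ open_\<Omega> z])
  from differentiableI[OF has_derivative_transform_within_open[OF has_derivative_D[OF this] open_\<Omega> z L[symmetric]]]
  have "hor M S ?L (chart_inv C z) C = hlift ?s z (fst (vloc ?L z))"
    by (rule hor_loc[OF z])
  then have "jacobi_endo M S (coord a) (chart_inv C z) C = ?br z - hlift ?s z 0 - hlift ?s z (fst (vloc ?L z))"
    using L[OF z] by (simp add: jacobi_endo_def)
  then show ?thesis
    using hlift bracket_preserves_energy[OF f euler geodesic z] linear_diff[OF lin] by simp
qed

lemma hlift_finsler:
  assumes F: "smooth_fun (T0M M) F" "homogeneous1_on (points (T0M M)) F"
    and geo: "geodesic_spray M F S" and z: "z \<in> \<Omega>"
  shows "D (loc (\<lambda>u. (F u)\<^sup>2)) z (hlift (vloc S) z a) = 0"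
  by (rule hlift_preserves_energy[OF smooth_loc[OF smooth_fun_square[OF F(1)]] euler_square[OF F]
        geodesic_loc[OF F geo] z])

lemma jacobi_finsler:
  assumes F: "smooth_fun (T0M M) F" "homogeneous1_on (points (T0M M)) F"
    and geo: "geodesic_spray M F S" and z: "z \<in> \<Omega>"
  shows "D (loc (\<lambda>u. (F u)\<^sup>2)) z (jacobi_endo M S (coord a) (chart_inv C z) C) = 0"
  by (rule jacobi_preserves_energy[OF smooth_loc[OF smooth_fun_square[OF F(1)]] euler_square[OF F]
        geodesic_loc[OF F geo] z])

end

section \<open>Comparison of the two Finsler functions\<close>

lemma homogeneous_T0M: "homogeneous1_on (points (TM M)) F \<Longrightarrow> homogeneous1_on (points (T0M M)) F"
  using points_T0M_TM by (auto simp: homogeneous1_on_def)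

lemma finsler_nonzero: "finsler_function M F \<Longrightarrow> z \<in> \<Omega> \<Longrightarrow> loc F z \<noteq> 0"
  using points_T0M_TM inv_points unfolding finsler_function_def by blast

text \<open>The derivative of F^2 vanishes on the Jacobi endomorphism of S, which by
  \<open>jac\<close> and \<open>curv\<close> has the scalar curvature form of F0. After cancelling
  \<open>\<kappa>\<^sub>0\<close>, the Euler identity for F^2 and the rule d(F0^2) = 2 F0 dF0 give
  the claim, which says that F^2/F0^2 has no vertical derivative.\<close>

lemma same_jacobi_vertical:
  assumes F\<^sub>0: "finsler_function M F\<^sub>0" and curv: "scalar_flag_curvature M F\<^sub>0 S\<^sub>0 \<kappa>\<^sub>0"
    and \<kappa>\<^sub>0: "\<forall>u\<in>points (T0M M). \<kappa>\<^sub>0 u \<noteq> 0"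
    and jac: "vform1_eq (T0M M) (jacobi_endo M S\<^sub>0) (jacobi_endo M S)"
    and F: "finsler_function M F" and geo: "geodesic_spray M F S" and z: "z \<in> \<Omega>"
  shows "loc (\<lambda>u. (F\<^sub>0 u)\<^sup>2) z * D (loc (\<lambda>u. (F u)\<^sup>2)) z (0, a)
       = loc (\<lambda>u. (F u)\<^sup>2) z * D (loc (\<lambda>u. (F\<^sub>0 u)\<^sup>2)) z (0, a)"
proof -
  let ?u = "chart_inv C z" and ?f = "loc (\<lambda>u. (F u)\<^sup>2)"
  have sF: "smooth_fun (T0M M) F" "homogeneous1_on (points (T0M M)) F"
    and sF\<^sub>0: "smooth_fun (T0M M) F\<^sub>0"
    using F F\<^sub>0 homogeneous_T0M by (auto simp: finsler_function_def)
  note lin = linear_D[OF smooth_on_differentiable[OF smooth_loc[OF smooth_fun_square[OF sF(1)]] open_\<Omega> z]]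
  have u: "?u \<in> fst C" using C_inv[OF z] by simp
  have "jacobi_endo M S (coord a) ?u C
      = \<kappa>\<^sub>0 ?u *\<^sub>R ((F\<^sub>0 ?u)\<^sup>2 *\<^sub>R tan_J (coord a) ?u C
          - (F\<^sub>0 ?u * d_along (T0M M) tan_J F\<^sub>0 (coord a) ?u) *\<^sub>R liouville M ?u C)"
    using curv jac coord_vector_field[of a] u
    unfolding scalar_flag_curvature_def vform1_eq_def by (metis (no_types, lifting))
  also have "\<dots> = \<kappa>\<^sub>0 ?u *\<^sub>R ((F\<^sub>0 ?u)\<^sup>2 *\<^sub>R (0, a) - (F\<^sub>0 ?u * D (loc F\<^sub>0) z (0, a)) *\<^sub>R (0, snd z))"
    using d_along_J_loc[of z "coord a", OF z T.vf_tangent[OF coord_vector_field u] sF\<^sub>0] vloc_coord[OF z]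
      liouville_loc[OF z] by (simp add: tan_J_def)
  finally have "\<kappa>\<^sub>0 ?u * ((F\<^sub>0 ?u)\<^sup>2 * D ?f z (0, a) - (F\<^sub>0 ?u * D (loc F\<^sub>0) z (0, a)) * D ?f z (0, snd z)) = 0"
    using jacobi_finsler[OF _ sF geo z, of a] geo
    by (simp only: geodesic_spray_def linear_scale[OF lin] linear_diff[OF lin] real_scaleR_def)
  then have "(F\<^sub>0 ?u)\<^sup>2 * D ?f z (0, a) - (F\<^sub>0 ?u * D (loc F\<^sub>0) z (0, a)) * D ?f z (0, snd z) = 0"
    using \<kappa>\<^sub>0 inv_points[OF z] by simp
  then show ?thesis
    using euler_square[OF sF z] D_square[OF sF\<^sub>0 z] by (simp add: algebra_simps)
qed

lemma projective_factor_zero: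
  assumes dim: "2 \<le> DIM('e)"
    and F\<^sub>0: "finsler_function M F\<^sub>0" and geo\<^sub>0: "geodesic_spray M F\<^sub>0 S\<^sub>0"
    and curv: "scalar_flag_curvature M F\<^sub>0 S\<^sub>0 \<kappa>\<^sub>0" and \<kappa>\<^sub>0: "\<forall>u\<in>points (T0M M). \<kappa>\<^sub>0 u \<noteq> 0"
    and P: "funk_function M S\<^sub>0 P"
    and F: "finsler_function M F" and geo: "geodesic_spray M F (projective_change M S\<^sub>0 P)"
    and z: "z \<in> \<Omega>"
  shows "loc P z = 0"
proof -
  let ?S = "projective_change M S\<^sub>0 P"
  have sF: "smooth_fun (T0M M) F" "homogeneous1_on (points (T0M M)) F"
    and sF\<^sub>0: "smooth_fun (T0M M) F\<^sub>0" "homogeneous1_on (points (T0M M)) F\<^sub>0"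
    and sP: "smooth_fun (T0M M) P" "homogeneous1_on (points (T0M M)) P"
    and jac: "vform1_eq (T0M M) (jacobi_endo M S\<^sub>0) (jacobi_endo M ?S)"
    using F F\<^sub>0 P homogeneous_T0M by (auto simp: finsler_function_def funk_function_def)
  have S\<^sub>0: "spray M S\<^sub>0" and S: "spray M ?S" using geo\<^sub>0 geo by (auto simp: geodesic_spray_def)
  show ?thesis
  proof (rule projective_factor_vanishes[OF dim open_V smooth_loc[OF smooth_fun_square[OF sF(1)]]
        smooth_loc[OF smooth_fun_square[OF sF\<^sub>0(1)]] smooth_loc[OF sP(1)]
        spray_chart.smooth_s[OF spray_chart[OF S\<^sub>0]] _ _ euler_square[OF sF\<^sub>0]
        euler_loc[OF sP(2,1)] hlift_finsler[OF S\<^sub>0 sF\<^sub>0 geo\<^sub>0] hlift_finsler[OF S sF geo] _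
        same_jacobi_vertical[OF F\<^sub>0 curv \<kappa>\<^sub>0 jac F geo] z])
    show "loc (\<lambda>u. (F\<^sub>0 u)\<^sup>2) z \<noteq> 0" "loc (\<lambda>u. (F u)\<^sup>2) z \<noteq> 0" if "z \<in> \<Omega>" for z
      using finsler_nonzero that F F\<^sub>0 by auto
    show "vloc ?S z = vloc S\<^sub>0 z - (2 * loc P z) *\<^sub>R (0, snd z)" if "z \<in> \<Omega>" for z
      using liouville_loc[OF that] by (simp add: projective_change_def)
  qed
qed

end

theorem theorem3p1:
  fixes M :: "('m, real ^ 'n) chart set"
    and F\<^sub>0 :: "('m, real ^ 'n) tpoint \<Rightarrow> real"
    and \<kappa>\<^sub>0 :: "('m, real ^ 'n) tpoint \<Rightarrow> real"
    and S\<^sub>0 :: "('m, real ^ 'n) T_vfield"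
  assumes "smooth_manifold M"
    and "connected_space (atlas_topology M)"
    and "CARD('n) \<ge> 2"
    and "finsler_function M F\<^sub>0"
    and "geodesic_spray M F\<^sub>0 S\<^sub>0"
    and "scalar_flag_curvature M F\<^sub>0 S\<^sub>0 \<kappa>\<^sub>0"
    and "\<forall>u\<in>points (T0M M). \<kappa>\<^sub>0 u \<noteq> 0"
  shows "\<not> (\<exists>P. funk_function M S\<^sub>0 P \<and>
               (\<exists>u\<in>points (T0M M). P u \<noteq> 0) \<and>
               finsler_metrizable M (projective_change M S\<^sub>0 P))"
proof
  assume "\<exists>P. funk_function M S\<^sub>0 P \<and> (\<exists>u\<in>points (T0M M). P u \<noteq> 0) \<and>
    finsler_metrizable M (projective_change M S\<^sub>0 P)"
  then obtain P u F where P: "funk_function M S\<^sub>0 P" and u: "u \<in> points (T0M M)" "P u \<noteq> 0"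
    and F: "finsler_function M F" "geodesic_spray M F (projective_change M S\<^sub>0 P)"
    by (auto simp: finsler_metrizable_def)
  \<comment> \<open>The vanishing of P is local, so an induced chart around the single point
    \<open>u\<close> suffices.\<close>
  obtain c where cu: "c \<in> M" "u \<in> fst (T0M_chart M c)"
    using u(1) by (auto simp: points_def T0M_def)
  interpret T0M_chart_at M c
    by unfold_locales (use assms(1) cu in \<open>auto simp: smooth_manifold_def\<close>)
  have "P (chart_inv C (snd C u)) = 0"
    by (rule projective_factor_zero[OF _ assms(4-7) P F C_mem[OF cu(2)]]) (use assms(3) in simp)
  then show False using u(2) T.chart_inv_chart[OF C cu(2)] by simp
qed

end
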